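(* Let $G$ be an arithmetical groupoid, $\eta\colon G\to\mathbb G$ its abstract norm, $H$ a non-empty right-saturated subcategory of $G_+$, and $C=\mathbb G/\mathbf q(\eta(H))$. For $\mathcal G\in\mathbb G$ set $[\mathcal G]=\mathcal G\,\mathbf q(\eta(H))\in C$, and let $C_M=\{\,[\eta(u)]\in C\mid u\in\mathcal A(G_+)\,\}$. Assume that 1. for $a\in G$ with $s(a)\in H_0$, one has $a\in HH^{-1}$ if and only if $\eta(a)\in\mathbf q(\eta(H))$; 2. for every $e\in G_0$ and $g\in C_M$ there exists an element $u\in\mathcal A(G_+)$ such that $s(u)=e$ and $[\eta(u)]=g$. Then there exists a transfer homomorphism $\theta\colon H\to\mathcal B(C_M)$.
   Context: Small categories. A small category $H$ is identified with its set of morphisms; $H_0\subset H$ is the set of identity morphisms, $s,t\colon H\to H_0$ are source and target, and $ab$ is defined iff $t(a)=s(b)$. For $e,f\in H_0$: $H(e,f)=\{a\mid s(a)=e,t(a)=f\}$, $H(e)=H(e,e)$, $H(e,\cdot)=\{a\mid s(a)=e\}$, $H(\cdot,f)=\{a\mid t(a)=f\}$. $H^\times$ is the set of isomorphisms; $H$ is reduced if $H^\times=H_0$, and cancellative if all morphisms are left- and right-cancellable. A semigroup is a small category with one identity. An atom of a cancellative $H$ is a $u\in H\setminus H^\times$ such that $u=bc$ implies $b\in H^\times$ or $c\in H^\times$; $\mathcal A(H)$ is the set of atoms. A groupoid is a small category in which every morphism is invertible. Lattice-ordered groupoid: a groupoid $G$ with a relation $\le$ such that for all $e,f\in G_0$,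 $\le$ restricts to a lattice order on $G(e,\cdot)$ and on $G(\cdot,f)$, and $G(e,f)$ is a sublattice of both, the meets and joins of elements of $G(e,f)$ being the same in both. An element $a$ is integral if $a\le s(a)$ and $a\le t(a)$; $G_+$ is the set of integral elements. $G$ is an arithmetical groupoid if for all $e,f\in G_0$: (P1) for $a\in G$, $a\le s(a)$ iff $a\le t(a)$; (P2) $G(e,\cdot)$ and $G(\cdot,f)$ are modular lattices; (P3) if $a\le b$ in $G(e,\cdot)$ and $c\in G(\cdot,e)$ then $ca\le cb$; if $a\le b$ in $G(\cdot,f)$ and $c\in G(f,\cdot)$ then $ac\le bc$; (P4) every non-empty $M\subset G(e,\cdot)\cap G_+$ has a supremum in $G(e,\cdot)$, every non-empty $M\subset G(\cdot,f)\cap G_+$ has a supremum in $G(\cdot,f)$, and for non-empty $M\subset G(e,f)\cap G_+$ these suprema coincide; (P5) $G(e,f)$ contains an integral element; (P6) $G(e,\cdot)$ and $G(\cdot,f)$ satisfy the ACC on integral elements. Then $G_+$ is a reduced subcategory of $G$ containing all identities. Universal vertex group and abstract norm. For an arithmetical groupoid $G$ all vertex groups $G(e)$ are abelian, and for $a\in G(e,f)$ the isomorphism $G(e)\to G(f)$, $x\mapsto a^{-1}xa$, does not depend on $a$. The universal vertex group $\mathbb G$ is the abelian group obtained by identifying all $G(e)$ via these isomorphisms; $\mathcal X_e\in G(e)$ denotes the representative of $\mathcal X\in\mathbb G$. $\mathbb G$ carries the order of $G(e)$ (independent of $e$). For $a\in G$, $\Phi(a)=\sup\{\mathcal X\in\mathbb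 G\mid\mathcal X_{s(a)}\le a\}$. The abstract norm $\eta\colon G\to\mathbb G$ is the unique groupoid homomorphism with $\eta(u)=\Phi(u)$ for all $u\in\mathcal A(G_+)$ (it exists and is surjective). For a subcategory $H\subset G_+$ (closed under composition and containing $s(a),t(a)$ for $a\in H$), $HH^{-1}=\{ab^{-1}\mid a,b\in H,\ t(a)=t(b)\}$; $H\subset G_+$ is right-saturated if $HH^{-1}\cap G_+=H$. $\mathbf q(\eta(H))$ is the subgroup of $\mathbb G$ generated by $\eta(H)$. For a subset $C_M$ of an abelian group $C$, $\mathcal B(C_M)$ is the monoid of zero-sum sequences: the submonoid of the free abelian monoid with basis $C_M$ of all $g_1\cdot\ldots\cdot g_l$ whose sum in $C$ is $0$. A homomorphism (functor) $\theta\colon H\to B$ from a cancellative small category to a reduced cancellative small category is a transfer homomorphism if (T1) $\theta(H)=B$ and $\theta^{-1}(B_0)=H^\times$; (T2) if $\theta(a)=b_1b_2$ with $a\in H$, $b_1,b_2\in B$, there are $a_1,a_2\in H$ with $a=a_1a_2$, $\theta(a_1)=b_1$, $\theta(a_2)=b_2$. *)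

theory Defs
  imports "HOL-Algebra.Generated_Groups" "HOL-Algebra.Lattice" "HOL-Algebra.FiniteProduct"
    "HOL-Library.Multiset"
begin

section \<open>Small categories\<close>

text \<open>
  A small category is given by its set of morphisms; objects are identified with identity
  morphisms. Composition is written in diagrammatic order: \<open>a \<cdot> b\<close> is meaningful
  iff \<^term>\<open>tgt C a = src C b\<close>, and the value of \<open>cmp\<close> is unconstrained otherwise.
\<close>

record 'a cat = "'a partial_object" +
  src :: "'a \<Rightarrow> 'a"
  tgt :: "'a \<Rightarrow> 'a"
  cmp :: "'a \<Rightarrow> 'a \<Rightarrow> 'a"  (infixl \<open>\<cdot>\<index>\<close> 70)

locale small_category =
  fixes C :: "('a, 'b) cat_scheme" (structure)
  assumes src_closed: "a \<in> carrier C \<Longrightarrow> src C a \<in> carrier C"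
    and tgt_closed: "a \<in> carrier C \<Longrightarrow> tgt C a \<in> carrier C"
    and src_src: "a \<in> carrier C \<Longrightarrow> src C (src C a) = src C a"
    and tgt_src: "a \<in> carrier C \<Longrightarrow> tgt C (src C a) = src C a"
    and src_tgt: "a \<in> carrier C \<Longrightarrow> src C (tgt C a) = tgt C a"
    and tgt_tgt: "a \<in> carrier C \<Longrightarrow> tgt C (tgt C a) = tgt C a"
    and cmp_closed: "\<lbrakk>a \<in> carrier C; b \<in> carrier C; tgt C a = src C b\<rbrakk> \<Longrightarrow> a \<cdot> b \<in> carrier C"
    and src_cmp: "\<lbrakk>a \<in> carrier C; b \<in> carrier C; tgt C a = src C b\<rbrakk> \<Longrightarrow> src C (a \<cdot> b) = src C a"
    and tgt_cmp: "\<lbrakk>a \<in> carrier C; b \<in> carrier C; tgt C a = src C b\<rbrakk> \<Longrightarrow> tgt C (a \<cdot> b) = tgt C b"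
    and cmp_assoc: "\<lbrakk>a \<in> carrier C; b \<in> carrier C; c \<in> carrier C;
                     tgt C a = src C b; tgt C b = src C c\<rbrakk> \<Longrightarrow> (a \<cdot> b) \<cdot> c = a \<cdot> (b \<cdot> c)"
    and src_unit: "a \<in> carrier C \<Longrightarrow> src C a \<cdot> a = a"
    and tgt_unit: "a \<in> carrier C \<Longrightarrow> a \<cdot> tgt C a = a"

definition ids :: "('a, 'b) cat_scheme \<Rightarrow> 'a set" where
  "ids C = {e \<in> carrier C. src C e = e}"

definition Hom :: "('a, 'b) cat_scheme \<Rightarrow> 'a \<Rightarrow> 'a \<Rightarrow> 'a set" where
  "Hom C e f = {a \<in> carrier C. src C a = e \<and> tgt C a = f}"

definition Out :: "('a, 'b) cat_scheme \<Rightarrow> 'a \<Rightarrow> 'a set" where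
  "Out C e = {a \<in> carrier C. src C a = e}"

definition In :: "('a, 'b) cat_scheme \<Rightarrow> 'a \<Rightarrow> 'a set" where
  "In C f = {a \<in> carrier C. tgt C a = f}"

definition isos :: "('a, 'b) cat_scheme \<Rightarrow> 'a set" where
  "isos C = {a \<in> carrier C. \<exists>b \<in> Hom C (tgt C a) (src C a).
     a \<cdot>\<^bsub>C\<^esub> b = src C a \<and> b \<cdot>\<^bsub>C\<^esub> a = tgt C a}"

definition reduced :: "('a, 'b) cat_scheme \<Rightarrow> bool" where
  "reduced C \<longleftrightarrow> isos C = ids C"

definition cancellative :: "('a, 'b) cat_scheme \<Rightarrow> bool" where
  "cancellative C \<longleftrightarrow>
     (\<forall>a\<in>carrier C. \<forall>b\<in>carrier C. \<forall>c\<in>carrier C.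
        (tgt C a = src C b \<and> tgt C a = src C c \<and> a \<cdot>\<^bsub>C\<^esub> b = a \<cdot>\<^bsub>C\<^esub> c \<longrightarrow> b = c) \<and>
        (tgt C b = src C a \<and> tgt C c = src C a \<and> b \<cdot>\<^bsub>C\<^esub> a = c \<cdot>\<^bsub>C\<^esub> a \<longrightarrow> b = c))"

definition atoms :: "('a, 'b) cat_scheme \<Rightarrow> 'a set" where
  "atoms C = {u \<in> carrier C - isos C.
     \<forall>b\<in>carrier C. \<forall>c\<in>carrier C.
       tgt C b = src C c \<and> u = b \<cdot>\<^bsub>C\<^esub> c \<longrightarrow> b \<in> isos C \<or> c \<in> isos C}"

text \<open>Only meaningful for sets of morphisms closed under the operations of the category.\<close>

abbreviation restrict_cat :: "('a, 'b) cat_scheme \<Rightarrow> 'a set \<Rightarrow> ('a, 'b) cat_scheme" where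
  "restrict_cat C H \<equiv> C\<lparr>carrier := H\<rparr>"

definition subcategory :: "('a, 'b) cat_scheme \<Rightarrow> 'a set \<Rightarrow> bool" where
  "subcategory C H \<longleftrightarrow> H \<subseteq> carrier C \<and>
     (\<forall>a\<in>H. src C a \<in> H \<and> tgt C a \<in> H) \<and>
     (\<forall>a\<in>H. \<forall>b\<in>H. tgt C a = src C b \<longrightarrow> a \<cdot>\<^bsub>C\<^esub> b \<in> H)"

definition cat_hom :: "('a, 'c) cat_scheme \<Rightarrow> ('b, 'd) cat_scheme \<Rightarrow> ('a \<Rightarrow> 'b) \<Rightarrow> bool" where
  "cat_hom C D \<theta> \<longleftrightarrow>
     (\<forall>a\<in>carrier C. \<theta> a \<in> carrier D \<and>
        \<theta> (src C a) = src D (\<theta> a) \<and> \<theta> (tgt C a) = tgt D (\<theta> a)) \<and>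
     (\<forall>a\<in>carrier C. \<forall>b\<in>carrier C. tgt C a = src C b \<longrightarrow>
        \<theta> (a \<cdot>\<^bsub>C\<^esub> b) = \<theta> a \<cdot>\<^bsub>D\<^esub> \<theta> b)"

definition cat_of_monoid :: "('a, 'b) monoid_scheme \<Rightarrow> 'a cat" where
  "cat_of_monoid M =
     \<lparr>carrier = carrier M, src = (\<lambda>_. \<one>\<^bsub>M\<^esub>), tgt = (\<lambda>_. \<one>\<^bsub>M\<^esub>), cmp = (\<otimes>\<^bsub>M\<^esub>)\<rparr>"

definition transfer_hom :: "('a, 'c) cat_scheme \<Rightarrow> ('b, 'd) cat_scheme \<Rightarrow> ('a \<Rightarrow> 'b) \<Rightarrow> bool" where
  "transfer_hom H B \<theta> \<longleftrightarrow>
     small_category H \<and> cancellative H \<and>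
     small_category B \<and> cancellative B \<and> reduced B \<and>
     cat_hom H B \<theta> \<and>
     \<theta> ` carrier H = carrier B \<and> {a \<in> carrier H. \<theta> a \<in> ids B} = isos H \<and>
     (\<forall>a\<in>carrier H. \<forall>b1\<in>carrier B. \<forall>b2\<in>carrier B.
        tgt B b1 = src B b2 \<and> \<theta> a = b1 \<cdot>\<^bsub>B\<^esub> b2 \<longrightarrow>
        (\<exists>a1\<in>carrier H. \<exists>a2\<in>carrier H. tgt H a1 = src H a2 \<and>
           a = a1 \<cdot>\<^bsub>H\<^esub> a2 \<and> \<theta> a1 = b1 \<and> \<theta> a2 = b2))"

section \<open>Groupoids and arithmetical groupoids\<close>

locale groupoid = small_category G for G :: "('a, 'b) cat_scheme" (structure) +
  assumes all_isos: "isos G = carrier G"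

definition ginv :: "('a, 'b) cat_scheme \<Rightarrow> 'a \<Rightarrow> 'a" where
  "ginv G a = (THE b. b \<in> Hom G (tgt G a) (src G a) \<and>
     a \<cdot>\<^bsub>G\<^esub> b = src G a \<and> b \<cdot>\<^bsub>G\<^esub> a = tgt G a)"

record 'a ord_cat = "'a cat" +
  leq :: "'a \<Rightarrow> 'a \<Rightarrow> bool"  (infixl \<open>\<preceq>\<index>\<close> 50)

definition poset_on :: "('a, 'b) ord_cat_scheme \<Rightarrow> 'a set \<Rightarrow> 'a gorder" where
  "poset_on G S = \<lparr>carrier = S, eq = (=), le = leq G\<rparr>"

abbreviation out_poset :: "('a, 'b) ord_cat_scheme \<Rightarrow> 'a \<Rightarrow> 'a gorder" where
  "out_poset G e \<equiv> poset_on G (Out G e)"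

abbreviation in_poset :: "('a, 'b) ord_cat_scheme \<Rightarrow> 'a \<Rightarrow> 'a gorder" where
  "in_poset G f \<equiv> poset_on G (In G f)"

text \<open>No condition is imposed on \<open>\<preceq>\<close> between morphisms that share neither source nor target.\<close>

locale lattice_ordered_groupoid = groupoid G for G :: "('a, 'b) ord_cat_scheme" (structure) +
  assumes out_lattice: "e \<in> ids G \<Longrightarrow> Lattice.lattice (out_poset G e)"
    and in_lattice: "f \<in> ids G \<Longrightarrow> Lattice.lattice (in_poset G f)"
    and join_Hom: "\<lbrakk>e \<in> ids G; f \<in> ids G; x \<in> Hom G e f; y \<in> Hom G e f\<rbrakk> \<Longrightarrow>
          x \<squnion>\<^bsub>out_poset G e\<^esub> y \<in> Hom G e f \<and> x \<squnion>\<^bsub>out_poset G e\<^esub> y = x \<squnion>\<^bsub>in_poset G f\<^esub> y"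
    and meet_Hom: "\<lbrakk>e \<in> ids G; f \<in> ids G; x \<in> Hom G e f; y \<in> Hom G e f\<rbrakk> \<Longrightarrow>
          x \<sqinter>\<^bsub>out_poset G e\<^esub> y \<in> Hom G e f \<and> x \<sqinter>\<^bsub>out_poset G e\<^esub> y = x \<sqinter>\<^bsub>in_poset G f\<^esub> y"

definition integral :: "('a, 'b) ord_cat_scheme \<Rightarrow> 'a set" where
  "integral G = {a \<in> carrier G. a \<preceq>\<^bsub>G\<^esub> src G a \<and> a \<preceq>\<^bsub>G\<^esub> tgt G a}"

definition modular :: "('a, 'b) gorder_scheme \<Rightarrow> bool" where
  "modular L \<longleftrightarrow> (\<forall>x\<in>carrier L. \<forall>y\<in>carrier L. \<forall>z\<in>carrier L.
     x \<sqsubseteq>\<^bsub>L\<^esub> z \<longrightarrow> x \<squnion>\<^bsub>L\<^esub> (y \<sqinter>\<^bsub>L\<^esub> z) = (x \<squnion>\<^bsub>L\<^esub> y) \<sqinter>\<^bsub>L\<^esub> z)"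

definition acc_on :: "('a, 'b) gorder_scheme \<Rightarrow> 'a set \<Rightarrow> bool" where
  "acc_on L S \<longleftrightarrow> (\<forall>x :: nat \<Rightarrow> 'a.
     (\<forall>n. x n \<in> S \<and> x n \<sqsubseteq>\<^bsub>L\<^esub> x (Suc n)) \<longrightarrow> (\<exists>N. \<forall>n\<ge>N. x n = x N))"

locale arithmetical_groupoid = lattice_ordered_groupoid G
  for G :: "('a, 'b) ord_cat_scheme" (structure) +
  assumes P1: "a \<in> carrier G \<Longrightarrow> a \<preceq> src G a \<longleftrightarrow> a \<preceq> tgt G a"
    and P2_out: "e \<in> ids G \<Longrightarrow> modular (out_poset G e)"
    and P2_in: "f \<in> ids G \<Longrightarrow> modular (in_poset G f)"
    and P3_left: "\<lbrakk>e \<in> ids G; a \<in> Out G e; b \<in> Out G e; a \<preceq> b; c \<in> In G e\<rbrakk> \<Longrightarrow> c \<cdot> a \<preceq> c \<cdot> b"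
    and P3_right: "\<lbrakk>f \<in> ids G; a \<in> In G f; b \<in> In G f; a \<preceq> b; c \<in> Out G f\<rbrakk> \<Longrightarrow> a \<cdot> c \<preceq> b \<cdot> c"
    and P4_out: "\<lbrakk>e \<in> ids G; M \<subseteq> Out G e \<inter> integral G; M \<noteq> {}\<rbrakk> \<Longrightarrow>
          \<exists>s. least (out_poset G e) s (Upper (out_poset G e) M)"
    and P4_in: "\<lbrakk>f \<in> ids G; M \<subseteq> In G f \<inter> integral G; M \<noteq> {}\<rbrakk> \<Longrightarrow>
          \<exists>s. least (in_poset G f) s (Upper (in_poset G f) M)"
    and P4_eq: "\<lbrakk>e \<in> ids G; f \<in> ids G; M \<subseteq> Hom G e f \<inter> integral G; M \<noteq> {}\<rbrakk> \<Longrightarrow>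
          \<Squnion>\<^bsub>out_poset G e\<^esub> M = \<Squnion>\<^bsub>in_poset G f\<^esub> M"
    and P5: "\<lbrakk>e \<in> ids G; f \<in> ids G\<rbrakk> \<Longrightarrow> Hom G e f \<inter> integral G \<noteq> {}"
    and P6_out: "e \<in> ids G \<Longrightarrow> acc_on (out_poset G e) (Out G e \<inter> integral G)"
    and P6_in: "f \<in> ids G \<Longrightarrow> acc_on (in_poset G f) (In G f \<inter> integral G)"

definition quotients :: "('a, 'b) cat_scheme \<Rightarrow> 'a set \<Rightarrow> 'a set" where
  "quotients G H = {a \<cdot>\<^bsub>G\<^esub> ginv G b | a b. a \<in> H \<and> b \<in> H \<and> tgt G a = tgt G b}"

definition right_saturated :: "('a, 'b) ord_cat_scheme \<Rightarrow> 'a set \<Rightarrow> bool" where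
  "right_saturated G H \<longleftrightarrow> quotients G H \<inter> integral G = H"

section \<open>Universal vertex group and abstract norm\<close>

text \<open>
  The vertex groups are glued along the isomorphisms \<open>x \<mapsto> a\<^sup>-\<^sup>1 x a\<close>: an element of
  the universal vertex group is a class of identified elements of the vertex groups. In an
  arithmetical groupoid such a class contains exactly one element of each vertex group.
\<close>

definition vertex_elements :: "('a, 'b) cat_scheme \<Rightarrow> 'a set" where
  "vertex_elements G = (\<Union>e\<in>ids G. Hom G e e)"

definition vertex_conj :: "('a, 'b) cat_scheme \<Rightarrow> ('a \<times> 'a) set" where
  "vertex_conj G = {(x, ginv G a \<cdot>\<^bsub>G\<^esub> x \<cdot>\<^bsub>G\<^esub> a) | x a.
     x \<in> vertex_elements G \<and> a \<in> Out G (src G x)}"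

definition universal_vertex_group :: "('a, 'b) cat_scheme \<Rightarrow> 'a set monoid" where
  "universal_vertex_group G =
     \<lparr>carrier = vertex_elements G // vertex_conj G,
      monoid.mult = (\<lambda>X Y. {x \<cdot>\<^bsub>G\<^esub> y | x y. x \<in> X \<and> y \<in> Y \<and> src G x = src G y}),
      one = ids G\<rparr>"

definition rep_at :: "('a, 'b) cat_scheme \<Rightarrow> 'a \<Rightarrow> 'a set \<Rightarrow> 'a" where
  "rep_at G e X = (THE x. x \<in> X \<inter> Hom G e e)"

definition uvg_order :: "('a, 'b) ord_cat_scheme \<Rightarrow> 'a set gorder" where
  "uvg_order G =
     \<lparr>carrier = carrier (universal_vertex_group G), eq = (=),
      le = (\<lambda>X Y. \<forall>e\<in>ids G. rep_at G e X \<preceq>\<^bsub>G\<^esub> rep_at G e Y)\<rparr>"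

definition Phi :: "('a, 'b) ord_cat_scheme \<Rightarrow> 'a \<Rightarrow> 'a set" where
  "Phi G a = \<Squnion>\<^bsub>uvg_order G\<^esub>
     {X \<in> carrier (universal_vertex_group G). rep_at G (src G a) X \<preceq>\<^bsub>G\<^esub> a}"

text \<open>
  The abstract norm is the homomorphism determined by its values on atoms; it is unique only on
  \<^term>\<open>carrier G\<close>, so it is rendered as a predicate on functions.
\<close>

definition abstract_norm :: "('a, 'b) ord_cat_scheme \<Rightarrow> ('a \<Rightarrow> 'a set) \<Rightarrow> bool" where
  "abstract_norm G \<eta> \<longleftrightarrow>
     cat_hom G (cat_of_monoid (universal_vertex_group G)) \<eta> \<and>
     (\<forall>u \<in> atoms (restrict_cat G (integral G)). \<eta> u = Phi G u)"

definition norm_subgroup :: "('a, 'b) cat_scheme \<Rightarrow> ('a \<Rightarrow> 'a set) \<Rightarrow> 'a set \<Rightarrow> 'a set set" where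
  "norm_subgroup G \<eta> H = generate (universal_vertex_group G) (\<eta> ` H)"

definition norm_class ::
  "('a, 'b) cat_scheme \<Rightarrow> ('a \<Rightarrow> 'a set) \<Rightarrow> 'a set \<Rightarrow> 'a set \<Rightarrow> 'a set set" where
  "norm_class G \<eta> H X = norm_subgroup G \<eta> H #>\<^bsub>universal_vertex_group G\<^esub> X"

definition atom_classes ::
  "('a, 'b) ord_cat_scheme \<Rightarrow> ('a \<Rightarrow> 'a set) \<Rightarrow> 'a set \<Rightarrow> 'a set set set" where
  "atom_classes G \<eta> H =
     {norm_class G \<eta> H (\<eta> u) | u. u \<in> atoms (restrict_cat G (integral G))}"

section \<open>Monoids of zero-sum sequences\<close>

text \<open>
  The free abelian monoid with basis \<open>S\<close> consists of the finite multisets over \<open>S\<close>. The group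
  \<open>C\<close> is written multiplicatively, so the sum of a sequence is a product in \<open>C\<close>, with
  multiplicities as exponents.
\<close>

definition zero_sum_monoid :: "('c, 'd) monoid_scheme \<Rightarrow> 'c set \<Rightarrow> 'c multiset monoid" where
  "zero_sum_monoid C S =
     \<lparr>carrier = {M. set_mset M \<subseteq> S \<and>
        finprod C (\<lambda>g. g [^]\<^bsub>C\<^esub> count M g) (set_mset M) = \<one>\<^bsub>C\<^esub>},
      monoid.mult = (+), one = {#}\<rparr>"

end

theory Submission
  imports Defs
begin

text \<open>
  In an arithmetical groupoid distinct maximal integral elements of a vertex group commute, and by
  the chain condition they generate it; so vertex groups are abelian and, after gluing, the classes
  of these elements are the primes of the universal vertex group. For an atom \<open>u\<close> of \<open>G\<^sub>+\<close> the
  largest element of the vertex group below \<open>u\<close> is maximal integral, so \<open>\<Phi>(u)\<close> is prime. An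
  integral \<open>a\<close> therefore determines, through \<open>\<eta>(a)\<close>, the multiset of norms of the atoms in any of
  its factorizations. If a prime occurs in this multiset, then \<open>a\<close> is not comaximal to it, and a
  maximal integral element above both is an atom with that norm dividing \<open>a\<close> on the left: the norms
  can be split off in any order. Passing to classes modulo \<open>\<^bold>q(\<eta>(H))\<close> gives the transfer
  homomorphism; hypothesis 1 says that the factors of \<open>a \<in> H\<close> belonging to zero-sum subsequences
  lie in \<open>H\<close> again.
\<close>

section \<open>Groupoids\<close>

text \<open>The order compares only elements that share a source or a target, while a factorization
  runs through changing vertices. Divisibility is therefore read off at the source: an integral
  element divides \<open>a\<close> on the left exactly when it lies above \<open>a\<close> and has
  the same source. Primes, in contrast, belong to no particular vertex, because conjugation carries
  them from one vertex to another. The main obstacle is that atoms do not commute. If a prime occurs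
  late in a factorization, nothing exhibits an atom of that norm at the front. Comaximality with the
  prime overcomes this: it is a property of the element and not of a chosen factorization, it can be
  pushed past a first atom, and its failure supplies the atom that is wanted. How the remaining
  atoms change when that atom is split off never has to be known, since the norms of the cofactor
  are forced by unique factorization in the abelian group.\<close>

context small_category
begin

lemma idsD: "e \<in> ids C \<Longrightarrow> e \<in> carrier C \<and> src C e = e \<and> tgt C e = e"
  unfolding ids_def using tgt_src[of e] by auto

lemma src_ids [simp]: "a \<in> carrier C \<Longrightarrow> src C a \<in> ids C"
  and tgt_ids [simp]: "a \<in> carrier C \<Longrightarrow> tgt C a \<in> ids C"
  unfolding ids_def using src_closed tgt_closed src_src src_tgt by auto

lemma id_cmp [simp]: "\<lbrakk>a \<in> carrier C; src C a = e\<rbrakk> \<Longrightarrow> e \<cdot> a = a"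
  and cmp_id [simp]: "\<lbrakk>a \<in> carrier C; tgt C a = e\<rbrakk> \<Longrightarrow> a \<cdot> e = a"
  using src_unit tgt_unit by auto

declare src_closed [simp] tgt_closed [simp] src_src [simp] tgt_src [simp] src_tgt [simp]
  tgt_tgt [simp] cmp_closed [simp] src_cmp [simp] tgt_cmp [simp] cmp_assoc [simp]

end

section \<open>Inverses and cancellation\<close>

context groupoid
begin

lemma ginv_props:
  assumes a: "a \<in> carrier G"
  shows "ginv G a \<in> Hom G (tgt G a) (src G a) \<and>
    a \<cdot> ginv G a = src G a \<and> ginv G a \<cdot> a = tgt G a"
proof -
  obtain b where b: "b \<in> Hom G (tgt G a) (src G a)" "a \<cdot> b = src G a" "b \<cdot> a = tgt G a"
    using a all_isos unfolding isos_def by auto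
  have b': "b \<in> carrier G" "src G b = tgt G a" "tgt G b = src G a"
    using b(1) by (simp_all add: Hom_def)
  have "c = b" if c: "c \<in> Hom G (tgt G a) (src G a)" "a \<cdot> c = src G a" for c
  proof -
    have c': "c \<in> carrier G" "src G c = tgt G a" using c(1) by (simp_all add: Hom_def)
    have "(b \<cdot> a) \<cdot> c = b \<cdot> (a \<cdot> c)" using a b' c' by (intro cmp_assoc) simp_all
    then show ?thesis unfolding b(3) c(2) using b' c' by simp
  qed
  then have "\<exists>!b. b \<in> Hom G (tgt G a) (src G a) \<and> a \<cdot> b = src G a \<and> b \<cdot> a = tgt G a"
    using b by blast
  then show ?thesis unfolding ginv_def by (rule theI')
qed

lemma ginv_closed [simp]: "a \<in> carrier G \<Longrightarrow> ginv G a \<in> carrier G"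
  and src_ginv [simp]: "a \<in> carrier G \<Longrightarrow> src G (ginv G a) = tgt G a"
  and tgt_ginv [simp]: "a \<in> carrier G \<Longrightarrow> tgt G (ginv G a) = src G a"
  and cmp_ginv [simp]: "a \<in> carrier G \<Longrightarrow> a \<cdot> ginv G a = src G a"
  and ginv_cmp [simp]: "a \<in> carrier G \<Longrightarrow> ginv G a \<cdot> a = tgt G a"
  using ginv_props by (auto simp: Hom_def)

text \<open>With \<open>cmp_assoc\<close> as a simp rule products become right-nested, so an inverse
  pair is usually followed by a tail. The trailing factor lets the simplifier cancel the pair there
  too.\<close>

lemma cmp_ginv_cmp [simp]:
  "\<lbrakk>a \<in> carrier G; x \<in> carrier G; src G x = src G a\<rbrakk> \<Longrightarrow> a \<cdot> (ginv G a \<cdot> x) = x"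
  using cmp_assoc[of a "ginv G a" x] by simp

lemma ginv_cmp_cmp [simp]:
  "\<lbrakk>a \<in> carrier G; x \<in> carrier G; src G x = tgt G a\<rbrakk> \<Longrightarrow> ginv G a \<cdot> (a \<cdot> x) = x"
  using cmp_assoc[of "ginv G a" a x] by simp

lemma left_cancel:
  "\<lbrakk>a \<in> carrier G; x \<in> carrier G; y \<in> carrier G; src G x = tgt G a; src G y = tgt G a;
    a \<cdot> x = a \<cdot> y\<rbrakk> \<Longrightarrow> x = y"
  by (metis ginv_cmp_cmp)

lemma right_cancel:
  assumes "a \<in> carrier G" "x \<in> carrier G" "y \<in> carrier G" "tgt G x = src G a" "tgt G y = src G a"
    and eq: "x \<cdot> a = y \<cdot> a"
  shows "x = y"
proof -
  have "(x \<cdot> a) \<cdot> ginv G a = (y \<cdot> a) \<cdot> ginv G a"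
    by (simp only: eq)
  then show ?thesis using assms(1-5) by simp
qed

end

text \<open>If every element of \<open>T\<close> had a different one of \<open>T\<close> above it,
  dependent choice would give an ascending chain in \<open>S\<close> that never becomes
  stationary.\<close>

lemma acc_on_maximal:
  assumes acc: "acc_on L S" and T: "T \<subseteq> S" and ne: "T \<noteq> {}"
  shows "\<exists>m\<in>T. \<forall>y\<in>T. m \<sqsubseteq>\<^bsub>L\<^esub> y \<longrightarrow> y = m"
proof (rule ccontr)
  assume neg: "\<not> ?thesis"
  obtain t where t: "t \<in> T" using ne by blast
  obtain x :: "nat \<Rightarrow> 'a" where x: "\<forall>n. x n \<in> T" "\<forall>n. x n \<sqsubseteq>\<^bsub>L\<^esub> x (Suc n) \<and> x (Suc n) \<noteq> x n"
    using dependent_nat_choice[of "\<lambda>_ y. y \<in> T" "\<lambda>_ y z. y \<sqsubseteq>\<^bsub>L\<^esub> z \<and> z \<noteq> y"] t neg by blast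
  have "\<exists>N. \<forall>n\<ge>N. x n = x N"
    using acc T x unfolding acc_on_def by blast
  then obtain N where "\<forall>n\<ge>N. x n = x N" by blast
  then show False using x(2) by (metis le_add2 plus_1_eq_Suc)
qed

section \<open>Order in an arithmetical groupoid\<close>

context arithmetical_groupoid
begin

lemma partial_order_out: "e \<in> ids G \<Longrightarrow> partial_order (out_poset G e)"
  using out_lattice by (simp_all add: lattice_def upper_semilattice_def)

lemma le_refl [simp]: "a \<in> carrier G \<Longrightarrow> a \<preceq> a"
  using partial_order_out[THEN partial_order.axioms(1), THEN weak_partial_order.le_refl,
      of "src G a" a]
  by (simp add: poset_on_def Out_def)

lemma le_antisym: "\<lbrakk>a \<preceq> b; b \<preceq> a; a \<in> carrier G; b \<in> carrier G; src G a = src G b\<rbrakk> \<Longrightarrow> a = b"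
  using partial_order.le_antisym[OF partial_order_out, of "src G a" a b]
  by (simp add: poset_on_def Out_def)

text \<open>The law is taken from \<open>out_poset\<close>, so sources must agree while targets are
  free; later inequalities keep track of sources for this reason.\<close>

lemma le_trans:
  "\<lbrakk>a \<preceq> b; b \<preceq> c; a \<in> carrier G; b \<in> carrier G; c \<in> carrier G; src G a = src G b; src G b = src G c\<rbrakk>
    \<Longrightarrow> a \<preceq> c"
  using partial_order_out[THEN partial_order.axioms(1), THEN weak_partial_order.le_trans,
      of "src G a" a b c]
  by (simp add: poset_on_def Out_def)

lemma mult_left_mono:
  "\<lbrakk>a \<preceq> b; a \<in> carrier G; b \<in> carrier G; c \<in> carrier G; src G a = src G b; tgt G c = src G a\<rbrakk>
    \<Longrightarrow> c \<cdot> a \<preceq> c \<cdot> b"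
  using P3_left[of "src G a" a b c] by (simp add: Out_def In_def)

lemma mult_right_mono:
  "\<lbrakk>a \<preceq> b; a \<in> carrier G; b \<in> carrier G; c \<in> carrier G; tgt G a = tgt G b; tgt G a = src G c\<rbrakk>
    \<Longrightarrow> a \<cdot> c \<preceq> b \<cdot> c"
  using P3_right[of "tgt G a" a b c] by (simp add: Out_def In_def)

lemma integral_iff: "a \<in> integral G \<longleftrightarrow> a \<in> carrier G \<and> a \<preceq> src G a"
  unfolding integral_def using P1 by auto

lemma integral_cmp:
  assumes "a \<in> integral G" "b \<in> integral G" "tgt G a = src G b"
  shows "a \<cdot> b \<in> integral G"
proof -
  have "a \<cdot> b \<preceq> a \<cdot> src G b"
    using assms by (intro mult_left_mono) (auto simp: integral_iff)
  also have "a \<cdot> src G b = a" using assms by (auto simp: integral_iff)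
  finally show ?thesis
    using assms le_trans[of "a \<cdot> b" a "src G a"] by (auto simp: integral_iff)
qed

text \<open>Describing the join by bounds hides the ambient poset. The last clause comes from the
  sublattice axiom: a join inside a hom set keeps the target, so right multiplication can be applied
  to it.\<close>

lemma ex_join:
  assumes "a \<in> carrier G" "b \<in> carrier G" "src G a = src G b"
  obtains j where "j \<in> carrier G" "src G j = src G a" "a \<preceq> j" "b \<preceq> j"
    "\<And>z. \<lbrakk>z \<in> carrier G; src G z = src G a; a \<preceq> z; b \<preceq> z\<rbrakk> \<Longrightarrow> j \<preceq> z"
    "tgt G a = tgt G b \<Longrightarrow> tgt G j = tgt G a"
proof -
  let ?L = "out_poset G (src G a)"
  let ?j = "a \<squnion>\<^bsub>?L\<^esub> b"
  interpret L: Lattice.lattice ?L using out_lattice assms by simp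
  have ab: "a \<in> carrier ?L" "b \<in> carrier ?L" using assms by (auto simp: poset_on_def Out_def)
  show thesis
  proof
    show "?j \<in> carrier G" "src G ?j = src G a"
      using L.join_closed[OF ab] by (auto simp: poset_on_def Out_def)
    show "a \<preceq> ?j" "b \<preceq> ?j"
      using L.join_left[OF ab] L.join_right[OF ab] by (auto simp: poset_on_def)
    show "?j \<preceq> z" if "z \<in> carrier G" "src G z = src G a" "a \<preceq> z" "b \<preceq> z" for z
      using L.join_le[of a z b] ab that by (auto simp: poset_on_def Out_def)
    show "tgt G ?j = tgt G a" if "tgt G a = tgt G b"
      using join_Hom[of "src G a" "tgt G a" a b] assms that by (auto simp: Hom_def)
  qed
qed

lemma ex_meet:
  assumes "a \<in> carrier G" "b \<in> carrier G" "src G a = src G b"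
  obtains m where "m \<in> carrier G" "src G m = src G a" "m \<preceq> a" "m \<preceq> b"
    "tgt G a = tgt G b \<Longrightarrow> tgt G m = tgt G a"
proof -
  let ?L = "out_poset G (src G a)"
  let ?m = "a \<sqinter>\<^bsub>?L\<^esub> b"
  interpret L: Lattice.lattice ?L using out_lattice assms by simp
  have ab: "a \<in> carrier ?L" "b \<in> carrier ?L" using assms by (auto simp: poset_on_def Out_def)
  show thesis
  proof
    show "?m \<in> carrier G" "src G ?m = src G a"
      using L.meet_closed[OF ab] by (auto simp: poset_on_def Out_def)
    show "?m \<preceq> a" "?m \<preceq> b"
      using L.meet_left[OF ab] L.meet_right[OF ab] by (auto simp: poset_on_def)
    show "tgt G ?m = tgt G a" if "tgt G a = tgt G b"
      using meet_Hom[of "src G a" "tgt G a" a b] assms that by (auto simp: Hom_def)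
  qed
qed

lemma ex_maximal:
  assumes T: "T \<subseteq> Out G e \<inter> integral G" and ne: "T \<noteq> {}" and e: "e \<in> ids G"
  obtains m where "m \<in> T" "\<And>y. \<lbrakk>y \<in> T; m \<preceq> y\<rbrakk> \<Longrightarrow> y = m"
  using acc_on_maximal[OF P6_out[OF e] T ne] by (auto simp: poset_on_def)

text \<open>Splitting off a factor on the left keeps the target, so the relevant chain condition for
  factorizations from the left is the one on elements with a common target.\<close>

lemma integral_induct_in [consumes 1, case_names step]:
  assumes a: "a \<in> integral G"
    and step: "\<And>a. \<lbrakk>a \<in> integral G;
      \<And>b. \<lbrakk>b \<in> integral G; tgt G b = tgt G a; a \<preceq> b; b \<noteq> a\<rbrakk> \<Longrightarrow> P b\<rbrakk> \<Longrightarrow> P a"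
  shows "P a"
proof (rule ccontr)
  let ?T = "{b \<in> integral G. tgt G b = tgt G a \<and> \<not> P b}"
  assume "\<not> P a"
  then have ne: "?T \<noteq> {}" using a by auto
  have T: "?T \<subseteq> In G (tgt G a) \<inter> integral G" by (auto simp: In_def integral_iff)
  have acc: "acc_on (in_poset G (tgt G a)) (In G (tgt G a) \<inter> integral G)"
    using P6_in a by (simp add: integral_iff)
  obtain m where "m \<in> ?T" "\<And>y. \<lbrakk>y \<in> ?T; m \<preceq> y\<rbrakk> \<Longrightarrow> y = m"
    using acc_on_maximal[OF acc T ne] by (auto simp: poset_on_def)
  then show False using step[of m] by auto
qed

subsection \<open>Comaximal elements\<close>

text \<open>For integral elements with a common source this says that their join is the identity, as
  for two ideals whose sum is the whole order. The form with upper bounds makes no demand on the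
  targets.\<close>

definition comaximal :: "'a \<Rightarrow> 'a \<Rightarrow> bool" where
  "comaximal a b \<longleftrightarrow> (\<forall>z\<in>integral G. src G z = src G a \<and> a \<preceq> z \<and> b \<preceq> z \<longrightarrow> z = src G a)"

lemma comaximal_sym: "\<lbrakk>src G a = src G b; comaximal a b\<rbrakk> \<Longrightarrow> comaximal b a"
  by (auto simp: comaximal_def)

text \<open>The definition tests integral bounds only. The join is integral, because the identity is
  an upper bound of both elements, and it lies below every other bound.\<close>

lemma comaximalD:
  assumes "comaximal a b" "a \<in> integral G" "b \<in> integral G" "src G a = src G b"
    and "z \<in> carrier G" "src G z = src G a" "a \<preceq> z" "b \<preceq> z"
  shows "src G a \<preceq> z"
proof -
  have "a \<in> carrier G" "b \<in> carrier G" using assms by (simp_all add: integral_iff)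
  then obtain j where j: "j \<in> carrier G" "src G j = src G a" "a \<preceq> j" "b \<preceq> j"
      "\<And>z. \<lbrakk>z \<in> carrier G; src G z = src G a; a \<preceq> z; b \<preceq> z\<rbrakk> \<Longrightarrow> j \<preceq> z"
    by (rule ex_join) (use assms(4) in blast)+
  have "j \<in> integral G"
    using j(1,2) j(5)[of "src G a"] assms by (auto simp: integral_iff)
  then have "j = src G a" using assms(1) j by (auto simp: comaximal_def)
  then show ?thesis using j(5)[of z] assms by simp
qed

text \<open>Left translation by \<open>c\<close> preserves order in both directions, so the bound
  \<open>z\<close> can be replaced by \<open>ginv G c \<cdot> z\<close>.\<close>

lemma comaximal_mult_left:
  assumes "comaximal a b" "a \<in> integral G" "b \<in> integral G" "src G a = src G b"
    and "c \<in> carrier G" "tgt G c = src G a" "z \<in> carrier G" "src G z = src G c"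
    and "c \<cdot> a \<preceq> z" "c \<cdot> b \<preceq> z"
  shows "c \<preceq> z"
proof -
  have *: "a \<in> carrier G" "b \<in> carrier G" using assms by (auto simp: integral_iff)
  have "a \<preceq> ginv G c \<cdot> z" "b \<preceq> ginv G c \<cdot> z"
    using mult_left_mono[of "c \<cdot> a" z "ginv G c"] mult_left_mono[of "c \<cdot> b" z "ginv G c"]
      assms * by auto
  then have "src G a \<preceq> ginv G c \<cdot> z" using assms comaximalD by auto
  from mult_left_mono[OF this, of c] show ?thesis using assms * by auto
qed

text \<open>Right multiplication preserves the order only between elements with a common target. The
  detour through a join inside a single hom set allows arbitrary \<open>z\<close> with the right source.\<close>

lemma comaximal_mult_right:
  assumes "comaximal p q" "p \<in> integral G" "q \<in> integral G"
    and "p \<in> Hom G e e" "q \<in> Hom G e e"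
    and "c \<in> carrier G" "src G c = e" "z \<in> carrier G" "src G z = e"
    and "p \<cdot> c \<preceq> z" "q \<cdot> c \<preceq> z"
  shows "c \<preceq> z"
proof -
  have pq: "p \<in> carrier G" "src G p = e" "tgt G p = e" "q \<in> carrier G" "src G q = e" "tgt G q = e"
    using assms by (auto simp: Hom_def)
  have pqc: "p \<cdot> c \<in> carrier G" "q \<cdot> c \<in> carrier G"
      "src G (p \<cdot> c) = e" "src G (q \<cdot> c) = e" "tgt G (p \<cdot> c) = tgt G c" "tgt G (q \<cdot> c) = tgt G c"
    using assms pq by simp_all
  obtain w where w: "w \<in> carrier G" "src G w = e" "p \<cdot> c \<preceq> w" "q \<cdot> c \<preceq> w" "tgt G w = tgt G c"
      and wz: "\<And>z. \<lbrakk>z \<in> carrier G; src G z = e; p \<cdot> c \<preceq> z; q \<cdot> c \<preceq> z\<rbrakk> \<Longrightarrow> w \<preceq> z"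
    by (rule ex_join[OF pqc(1,2), unfolded pqc, OF refl]) (use that in blast)
  have "p \<preceq> w \<cdot> ginv G c" "q \<preceq> w \<cdot> ginv G c"
    using mult_right_mono[of "p \<cdot> c" w "ginv G c"] mult_right_mono[of "q \<cdot> c" w "ginv G c"]
      assms w pq by auto
  then have "e \<preceq> w \<cdot> ginv G c" using assms pq w comaximalD[of p q "w \<cdot> ginv G c"] by auto
  from mult_right_mono[OF this, of c] have "c \<preceq> w"
    using assms w pq by auto
  then show ?thesis using wz[of z] assms w le_trans[of c w z] by auto
qed

text \<open>A bound above \<open>p\<close> and \<open>a \<cdot> b\<close> is above
  \<open>a \<cdot> p \<preceq> p\<close> as well, hence above \<open>a\<close> because
  \<open>p\<close> and \<open>b\<close> are comaximal, and then above the identity because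
  \<open>p\<close> and \<open>a\<close> are.\<close>

lemma comaximal_mult:
  assumes "comaximal p a" "comaximal p b"
    and p: "p \<in> integral G" "p \<in> Hom G e e"
    and a: "a \<in> integral G" "a \<in> Hom G e e"
    and b: "b \<in> integral G" "src G b = e"
  shows "comaximal p (a \<cdot> b)"
  unfolding comaximal_def
proof (intro ballI impI)
  fix z assume z: "z \<in> integral G" and *: "src G z = src G p \<and> p \<preceq> z \<and> a \<cdot> b \<preceq> z"
  have c: "p \<in> carrier G" "src G p = e" "tgt G p = e" "a \<in> carrier G" "src G a = e" "tgt G a = e"
     "b \<in> carrier G" "z \<in> carrier G" "src G z = e" "e \<in> ids G" "e \<in> carrier G"
     using p a b z * by (auto simp: Hom_def integral_iff)
  have "a \<cdot> p \<preceq> p"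
    using mult_right_mono[of a e p] c a tgt_src[of a] by (auto simp: integral_iff)
  then have "a \<cdot> p \<preceq> z" using le_trans[of "a \<cdot> p" p z] c * by auto
  then have "a \<preceq> z" using comaximal_mult_left[OF assms(2) p(1) b(1), of a z] c b * by auto
  then have "e \<preceq> z" using comaximalD[OF assms(1) p(1) a(1), of z] c * by auto
  then show "z = src G p" using z c le_antisym[of z e] by (metis integral_iff src_src)
qed

end

subsection \<open>Vertex groups\<close>

context arithmetical_groupoid
begin

text \<open>Maximality is meant inside the vertex group. Larger integral elements with another
  target may exist, so these elements need not be atoms of the integral subcategory.\<close>

definition maxv :: "'a \<Rightarrow> 'a set" where
  "maxv e = {p \<in> Hom G e e \<inter> integral G. p \<noteq> e \<and>
     (\<forall>x\<in>Hom G e e \<inter> integral G. p \<preceq> x \<longrightarrow> x = p \<or> x = e)}"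

lemma maxvD:
  assumes "p \<in> maxv e"
  shows "p \<in> carrier G" "src G p = e" "tgt G p = e" "p \<preceq> e" "p \<in> integral G" "p \<noteq> e"
    "e \<in> carrier G" "e \<in> ids G" "src G e = e" "tgt G e = e"
  using assms src_src[of p] tgt_src[of p] src_closed[of p]
  by (auto simp: maxv_def Hom_def integral_iff)

lemma maxv_maximal:
  "\<lbrakk>p \<in> maxv e; x \<in> carrier G; src G x = e; tgt G x = e; p \<preceq> x; x \<preceq> e\<rbrakk> \<Longrightarrow> x = p \<or> x = e"
  by (auto simp: maxv_def Hom_def integral_iff)

text \<open>Since \<open>x\<close> also ends at \<open>e\<close>, its join with \<open>p\<close>
  stays in the vertex group, and maximality leaves only \<open>p\<close> and \<open>e\<close> as
  values.\<close>

lemma comaximal_maxv_iff: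
  assumes p: "p \<in> maxv e" and x: "x \<in> integral G" "src G x = e" "tgt G x = e"
  shows "comaximal p x \<longleftrightarrow> \<not> x \<preceq> p"
proof
  note pD = maxvD[OF p]
  show "\<not> x \<preceq> p" if "comaximal p x"
    using comaximalD[OF that, of p] pD x le_antisym[of p e] by (auto simp: integral_iff)
  assume nle: "\<not> x \<preceq> p"
  have xc: "x \<in> carrier G" "x \<preceq> e" using x by (auto simp: integral_iff)
  obtain j where j: "j \<in> carrier G" "src G j = e" "p \<preceq> j" "x \<preceq> j" "tgt G j = e"
      "\<And>z. \<lbrakk>z \<in> carrier G; src G z = e; p \<preceq> z; x \<preceq> z\<rbrakk> \<Longrightarrow> j \<preceq> z"
    by (rule ex_join[of p x, unfolded pD x, OF _ _ refl]) (use pD xc in blast)+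
  have "j \<preceq> e" using j(6)[of e] pD xc by simp
  then have "j = e" using maxv_maximal[OF p j(1,2,5,3)] nle j(4) by auto
  then show "comaximal p x"
    unfolding comaximal_def using j(6) pD le_antisym[of _ e] by (auto simp: integral_iff)
qed

text \<open>The element \<open>q \<cdot> z' \<cdot> p\<close> is the commutator of \<open>q\<close>
  with the inverse of \<open>p\<close>. It lies above \<open>p\<close> and above \<open>q\<close>,
  hence above \<open>e\<close> by comaximality; unwinding
  \<open>e \<preceq> q \<cdot> z' \<cdot> p\<close> gives the claim.\<close>

lemma comaximal_commute_le:
  assumes "comaximal p q" "p \<in> integral G" "q \<in> integral G" "p \<in> Hom G e e" "q \<in> Hom G e e"
  shows "q \<cdot> p \<preceq> p \<cdot> q"
proof -
  have c: "p \<in> carrier G" "src G p = e" "tgt G p = e" "p \<preceq> e" "q \<in> carrier G" "src G q = e" "tgt G q = e" "q \<preceq> e"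
    "e \<in> carrier G" "src G e = e" "tgt G e = e"
    using assms src_src[of p] tgt_src[of p] src_closed[of p] by (auto simp: Hom_def integral_iff)
  define z where "z = q \<cdot> p"
  define z' where "z' = ginv G z"
  have z: "z \<in> carrier G" "src G z = e" "tgt G z = e"
    "z' \<in> carrier G" "src G z' = e" "tgt G z' = e" "z \<cdot> z' = e" "z' \<cdot> z = e"
    using c by (simp_all add: z_def z'_def)
  have zp: "z \<preceq> p" using mult_right_mono[of q e p] c by (simp add: z_def)
  have zq: "z \<preceq> q" using mult_left_mono[of p e q] c by (simp add: z_def)
  have "e \<preceq> q \<cdot> z'" using mult_right_mono[OF zq, of z'] c z by simp
  from mult_right_mono[OF this, of p] have 1: "p \<preceq> q \<cdot> (z' \<cdot> p)" using c z by simp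
  have "e \<preceq> z' \<cdot> p" using mult_left_mono[OF zp, of z'] c z by simp
  from mult_left_mono[OF this, of q] have 2: "q \<preceq> q \<cdot> (z' \<cdot> p)" using c z by simp
  have "e \<preceq> q \<cdot> (z' \<cdot> p)" using comaximalD[OF assms(1-3) _ _ _ 1 2] c z by simp
  from mult_left_mono[OF this, of "ginv G q"] have "ginv G q \<preceq> z' \<cdot> p" using c z by simp
  from mult_left_mono[OF this, of z] have "z \<cdot> ginv G q \<preceq> p"
    using c z cmp_assoc[of z z' p] by simp
  from mult_right_mono[OF this, of q] have "z \<preceq> p \<cdot> q" using c z by simp
  then show ?thesis by (simp only: z_def)
qed

lemma maxv_commute:
  assumes p: "p \<in> maxv e" and q: "q \<in> maxv e"
  shows "p \<cdot> q = q \<cdot> p"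
proof (cases "p = q")
  case False
  note pD = maxvD[OF p] and qD = maxvD[OF q]
  have "\<not> q \<preceq> p" using maxv_maximal[OF q, of p] False pD by auto
  then have pq: "comaximal p q" using comaximal_maxv_iff[OF p] qD by simp
  have "p \<in> Hom G e e" "q \<in> Hom G e e" using pD qD by (auto simp: Hom_def)
  then have "q \<cdot> p \<preceq> p \<cdot> q" "p \<cdot> q \<preceq> q \<cdot> p"
    using comaximal_commute_le[OF pq] comaximal_commute_le[OF comaximal_sym[OF _ pq]] pD(2,5) qD(2,5)
    by metis+
  then show ?thesis using le_antisym[of "p \<cdot> q" "q \<cdot> p"] pD(1-3) qD(1-3) by simp
qed simp

text \<open>Behind this rule is the existence of factorizations within one vertex group: a maximal
  proper element \<open>p\<close> above \<open>x\<close> can be split off, and the cofactor lies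
  strictly above \<open>x\<close>, so the chain condition ends the process.\<close>

lemma integral_vertex_induct [consumes 2, case_names id mult]:
  assumes "x \<in> integral G" "x \<in> Hom G e e"
    and id: "P e"
    and mult: "\<And>p x. \<lbrakk>p \<in> maxv e; x \<in> integral G; x \<in> Hom G e e; P x\<rbrakk> \<Longrightarrow> P (p \<cdot> x)"
  shows "P x"
  using assms(1,2)
proof (induction x rule: integral_induct_in)
  case (step x)
  have xc: "x \<in> carrier G" "src G x = e" "tgt G x = e" "x \<preceq> e"
    using step.hyps step.prems by (auto simp: Hom_def integral_iff)
  have e: "e \<in> ids G" "e \<in> carrier G" "src G e = e" "tgt G e = e"
    using xc src_src[of x] tgt_src[of x] src_closed[of x] src_ids[of x] by auto
  show ?case
  proof (cases "x = e")
    case False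
    let ?T = "{y \<in> Hom G e e \<inter> integral G. x \<preceq> y \<and> y \<noteq> e}"
    have "x \<in> ?T" using step.hyps step.prems xc False by simp
    then have ne: "?T \<noteq> {}" by blast
    have T: "?T \<subseteq> Out G e \<inter> integral G" by (auto simp: Hom_def Out_def)
    obtain p where p: "p \<in> ?T" "\<And>y. \<lbrakk>y \<in> ?T; p \<preceq> y\<rbrakk> \<Longrightarrow> y = p"
      using ex_maximal[OF T ne e(1)] by blast
    have pc: "p \<in> carrier G" "src G p = e" "tgt G p = e" "p \<preceq> e" "p \<noteq> e" "x \<preceq> p"
      using p(1) by (auto simp: Hom_def integral_iff)
    have pm: "p \<in> maxv e"
      unfolding maxv_def using p pc xc le_trans[of x p] by (auto simp: Hom_def)
    define y where "y = ginv G p \<cdot> x"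
    have y: "y \<in> carrier G" "src G y = e" "tgt G y = e" "x = p \<cdot> y" using pc xc by (auto simp: y_def)
    have "y \<preceq> e" using mult_left_mono[OF pc(6), of "ginv G p"] pc xc by (simp add: y_def)
    then have yi: "y \<in> integral G" using y by (simp add: integral_iff)
    have xy: "x \<preceq> y" using mult_right_mono[OF pc(4), of y] y e pc by simp
    have "y \<noteq> x"
    proof
      assume "y = x"
      then have "p \<cdot> x = e \<cdot> x" using y(4) xc(1,2) by (metis id_cmp)
      then have "p = e" using right_cancel[of x p e] pc(1,2,3) xc(1,2) e by metis
      then show False using pc(5) by simp
    qed
    then have "P y" using step.IH[OF yi _ xy] y(1-3) xc(3) by (simp add: Hom_def)
    then show ?thesis using mult[OF pm yi] y by (simp add: Hom_def)
  qed (simp add: id)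
qed

lemma integral_vertex_commute:
  assumes x: "x \<in> integral G" "x \<in> Hom G e e" and y: "y \<in> integral G" "y \<in> Hom G e e"
  shows "x \<cdot> y = y \<cdot> x"
proof -
  \<comment> \<open>Used twice: first with an element of \<open>maxv e\<close> as \<open>z\<close>,
    where \<open>maxv_commute\<close> applies, and then with an arbitrary integral
    \<open>z\<close>.\<close>
  have step: "z \<cdot> x = x \<cdot> z"
    if x: "x \<in> integral G" "x \<in> Hom G e e" and z: "z \<in> carrier G" "src G z = e" "tgt G z = e"
      and zp: "\<And>p. p \<in> maxv e \<Longrightarrow> z \<cdot> p = p \<cdot> z" for x z
    using x
  proof (induction rule: integral_vertex_induct)
    case (mult p x)
    note pD = maxvD[OF mult.hyps(1)]
    have xc: "x \<in> carrier G" "src G x = e" "tgt G x = e"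
      using mult.hyps by (auto simp: Hom_def)
    have "z \<cdot> (p \<cdot> x) = (z \<cdot> p) \<cdot> x" using pD xc z by simp
    also have "\<dots> = (p \<cdot> z) \<cdot> x" by (simp only: zp[OF mult.hyps(1)])
    also have "\<dots> = p \<cdot> (z \<cdot> x)" using pD xc z by simp
    also have "\<dots> = p \<cdot> (x \<cdot> z)" by (simp only: mult.IH)
    finally show ?case using pD xc z by simp
  qed (use z in simp)
  have xc: "x \<in> carrier G" "src G x = e" "tgt G x = e"
    using x by (auto simp: Hom_def)
  have "x \<cdot> p = p \<cdot> x" if p: "p \<in> maxv e" for p
    using step[OF x maxvD(1-3)[OF p] maxv_commute[OF p]] by simp
  from step[OF y xc this] show ?thesis .
qed

text \<open>The numerator is the meet \<open>m\<close> of \<open>x\<close> and the identity. The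
  denominator is \<open>ginv G x \<cdot> m\<close>, which is integral because
  \<open>m \<preceq> x\<close>.\<close>

lemma vertex_quotient:
  assumes x: "x \<in> Hom G e e"
  obtains a b where "a \<in> integral G" "a \<in> Hom G e e" "b \<in> integral G" "b \<in> Hom G e e"
    "x = a \<cdot> ginv G b"
proof -
  have xc: "x \<in> carrier G" "src G x = e" "tgt G x = e"
    using x by (auto simp: Hom_def)
  have e: "e \<in> carrier G" "src G e = e" "tgt G e = e"
    using xc src_src[of x] tgt_src[of x] src_closed[of x] by auto
  obtain m where m: "m \<in> carrier G" "src G m = e" "m \<preceq> x" "m \<preceq> e" "tgt G m = e"
    by (rule ex_meet[of x e, unfolded xc e, OF _ _ refl]) (use xc e in blast)+
  show thesis
  proof
    show "m \<in> integral G" "m \<in> Hom G e e" using m by (auto simp: integral_iff Hom_def)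
    have "ginv G x \<cdot> m \<preceq> e" using mult_left_mono[OF m(3), of "ginv G x"] xc m by simp
    then show "ginv G x \<cdot> m \<in> integral G" "ginv G x \<cdot> m \<in> Hom G e e"
      using xc m by (auto simp: integral_iff Hom_def)
    have "x \<cdot> (ginv G x \<cdot> m) = m \<cdot> ginv G (ginv G x \<cdot> m) \<cdot> (ginv G x \<cdot> m)"
      using xc m by simp
    then show "x = m \<cdot> ginv G (ginv G x \<cdot> m)"
      using right_cancel[of "ginv G x \<cdot> m" x "m \<cdot> ginv G (ginv G x \<cdot> m)"] xc m by simp
  qed
qed

lemma commute_ginv:
  assumes "x \<in> Hom G e e" "y \<in> Hom G e e" "x \<cdot> y = y \<cdot> x"
  shows "x \<cdot> ginv G y = ginv G y \<cdot> x"
proof -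
  have c: "x \<in> carrier G" "src G x = e" "tgt G x = e" "y \<in> carrier G" "src G y = e" "tgt G y = e"
    using assms(1,2) by (auto simp: Hom_def)
  have "(x \<cdot> ginv G y) \<cdot> y = ginv G y \<cdot> (x \<cdot> y)"
    unfolding assms(3) using c by simp
  also have "\<dots> = (ginv G y \<cdot> x) \<cdot> y" using c by simp
  finally show ?thesis using right_cancel[of y "x \<cdot> ginv G y" "ginv G y \<cdot> x"] c by simp
qed

lemma vertex_commute:
  assumes x: "x \<in> Hom G e e" and y: "y \<in> Hom G e e"
  shows "x \<cdot> y = y \<cdot> x"
proof -
  obtain a b where ab: "a \<in> integral G" "a \<in> Hom G e e" "b \<in> integral G" "b \<in> Hom G e e"
    "x = a \<cdot> ginv G b" by (rule vertex_quotient[OF x])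
  obtain c d where cd: "c \<in> integral G" "c \<in> Hom G e e" "d \<in> integral G" "d \<in> Hom G e e"
    "y = c \<cdot> ginv G d" by (rule vertex_quotient[OF y])
  have comm: "u \<cdot> (v \<cdot> ginv G w) = (v \<cdot> ginv G w) \<cdot> u"
    if "u \<in> Hom G e e" "v \<in> Hom G e e" "w \<in> Hom G e e" "u \<cdot> v = v \<cdot> u" "u \<cdot> w = w \<cdot> u" for u v w
  proof -
    have c: "u \<in> carrier G" "src G u = e" "tgt G u = e" "v \<in> carrier G" "src G v = e" "tgt G v = e"
      "w \<in> carrier G" "src G w = e" "tgt G w = e"
      using that(1-3) by (auto simp: Hom_def)
    have "u \<cdot> (v \<cdot> ginv G w) = (u \<cdot> v) \<cdot> ginv G w" using c by simp
    also have "\<dots> = v \<cdot> (u \<cdot> ginv G w)" unfolding that(4) using c by simp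
    also have "\<dots> = v \<cdot> (ginv G w \<cdot> u)" by (simp only: commute_ginv[OF that(1,3,5)])
    finally show ?thesis using c by simp
  qed
  have "a \<cdot> y = y \<cdot> a" "b \<cdot> y = y \<cdot> b"
    unfolding cd(5) using ab cd integral_vertex_commute by (auto intro!: comm)
  then show ?thesis unfolding ab(5) using comm[OF y ab(2,4)] by simp
qed

end

section \<open>The universal vertex group\<close>

context arithmetical_groupoid
begin

abbreviation uvg :: "'a set monoid" where
  "uvg \<equiv> universal_vertex_group G"

definition transport :: "'a \<Rightarrow> 'a \<Rightarrow> 'a" where
  "transport a x = ginv G a \<cdot> (x \<cdot> a)"

text \<open>The orbit of \<open>x\<close> under conjugation by all arrows leaving its vertex; for a
  vertex element it is the class in the universal vertex group, by
  \<open>vertex_conj_image\<close>.\<close>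

definition vcls :: "'a \<Rightarrow> 'a set" where
  "vcls x = {transport a x | a. a \<in> carrier G \<and> src G a = src G x}"

lemma ginv_cmp_distrib:
  assumes "a \<in> carrier G" "b \<in> carrier G" "tgt G a = src G b"
  shows "ginv G (a \<cdot> b) = ginv G b \<cdot> ginv G a"
proof (rule left_cancel[of "a \<cdot> b"])
  show "a \<cdot> b \<cdot> ginv G (a \<cdot> b) = a \<cdot> b \<cdot> (ginv G b \<cdot> ginv G a)"
    using assms cmp_ginv[of "a \<cdot> b"] cmp_ginv[of a] by (simp del: cmp_ginv)
qed (use assms in simp_all)

lemma ginv_ginv [simp]: "a \<in> carrier G \<Longrightarrow> ginv G (ginv G a) = a"
  by (rule left_cancel[of "ginv G a"]) simp_all

lemma HomD:
  assumes "x \<in> Hom G e f"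
  shows "x \<in> carrier G" "src G x = e" "tgt G x = f"
  using assms by (auto simp: Hom_def)

lemma HomI: "\<lbrakk>x \<in> carrier G; src G x = e; tgt G x = f\<rbrakk> \<Longrightarrow> x \<in> Hom G e f"
  by (simp add: Hom_def)

lemma idsE:
  assumes "e \<in> ids G"
  shows "e \<in> carrier G" "src G e = e" "tgt G e = e" "e \<in> Hom G e e" "ginv G e = e"
proof -
  show e: "e \<in> carrier G" "src G e = e" "tgt G e = e" "e \<in> Hom G e e"
    using idsD[OF assms] by (auto simp: Hom_def)
  show "ginv G e = e" using cmp_ginv[of e] e by simp
qed

lemma transport_Hom:
  "\<lbrakk>a \<in> Hom G e f; x \<in> Hom G e e\<rbrakk> \<Longrightarrow> transport a x \<in> Hom G f f"
  by (auto simp: transport_def Hom_def)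

lemma transport_mult:
  "\<lbrakk>a \<in> Hom G e f; x \<in> Hom G e e; y \<in> Hom G e e\<rbrakk>
    \<Longrightarrow> transport a (x \<cdot> y) = transport a x \<cdot> transport a y"
  by (auto simp: transport_def Hom_def)

lemma transport_transport:
  "\<lbrakk>a \<in> Hom G e f; b \<in> Hom G f g; x \<in> Hom G e e\<rbrakk>
    \<Longrightarrow> transport b (transport a x) = transport (a \<cdot> b) x"
  by (auto simp: transport_def Hom_def ginv_cmp_distrib)

lemma cmp_transport: "\<lbrakk>a \<in> Hom G e f; x \<in> Hom G e e\<rbrakk> \<Longrightarrow> a \<cdot> transport a x = x \<cdot> a"
  by (auto simp: transport_def Hom_def)

text \<open>Commutativity makes conjugation by a loop trivial, which is why transport between two
  vertices does not depend on the arrow.\<close>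

lemma transport_vertex:
  assumes a: "a \<in> Hom G e e" and x: "x \<in> Hom G e e"
  shows "transport a x = x"
  using vertex_commute[OF x a] HomD[OF a] HomD[OF x] by (simp add: transport_def)

lemma transport_mono:
  assumes a: "a \<in> Hom G e f" and x: "x \<in> Hom G e e" and y: "y \<in> Hom G e e" and le: "x \<preceq> y"
  shows "transport a x \<preceq> transport a y"
proof -
  note c = HomD[OF a] HomD[OF x] HomD[OF y]
  have "x \<cdot> a \<preceq> y \<cdot> a" using mult_right_mono[OF le, of a] c by simp
  from mult_left_mono[OF this, of "ginv G a"] show ?thesis
    using c by (simp add: transport_def)
qed

lemma transport_ginv:
  assumes a: "a \<in> Hom G e f" and x: "x \<in> Hom G e e"
  shows "transport (ginv G a) (transport a x) = x"
  using HomD[OF a] HomD[OF x] by (simp add: transport_def)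

lemma ginv_Hom: "a \<in> Hom G e f \<Longrightarrow> ginv G a \<in> Hom G f e"
  by (auto simp: Hom_def)

lemma ex_Hom: "\<lbrakk>e \<in> ids G; f \<in> ids G\<rbrakk> \<Longrightarrow> \<exists>a. a \<in> Hom G e f \<inter> integral G"
  using P5 by blast

lemma src_Hom_ids: "a \<in> Hom G e f \<Longrightarrow> e \<in> ids G" and tgt_Hom_ids: "a \<in> Hom G e f \<Longrightarrow> f \<in> ids G"
  by (auto simp: Hom_def)

lemma vcls_transport:
  assumes a: "a \<in> Hom G e f" and x: "x \<in> Hom G e e"
  shows "vcls (transport a x) = vcls x"
proof (intro Set.set_eqI iffI)
  note c = HomD[OF a] HomD[OF x] HomD[OF transport_Hom[OF a x]]
  fix z
  show "z \<in> vcls x" if z: "z \<in> vcls (transport a x)"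
  proof -
    obtain b where b: "b \<in> carrier G" "src G b = f" "z = transport b (transport a x)"
      using z c by (auto simp: vcls_def)
    have "z = transport (a \<cdot> b) x" using transport_transport[OF a _ x, of b "tgt G b"] b by (simp add: Hom_def)
    then show ?thesis unfolding vcls_def using b c by auto
  qed
  show "z \<in> vcls (transport a x)" if z: "z \<in> vcls x"
  proof -
    obtain b where b: "b \<in> carrier G" "src G b = e" "z = transport b x"
      using z c by (auto simp: vcls_def)
    have "z = transport (ginv G a \<cdot> b) (transport a x)"
      using transport_transport[OF ginv_Hom[OF a] _ transport_Hom[OF a x], of b "tgt G b"] b
        transport_ginv[OF a x] by (simp add: Hom_def)
    moreover have "ginv G a \<cdot> b \<in> carrier G" "src G (ginv G a \<cdot> b) = src G (transport a x)"
      using b c by simp_all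
    ultimately show ?thesis unfolding vcls_def by blast
  qed
qed

text \<open>A member of the class that lies at \<open>e\<close> again was transported along a loop,
  so it has not moved.\<close>

lemma vcls_Hom:
  assumes x: "x \<in> Hom G e e"
  shows "vcls x \<inter> Hom G e e = {x}"
proof
  note c = HomD[OF x]
  show "vcls x \<inter> Hom G e e \<subseteq> {x}"
  proof
    fix z assume z: "z \<in> vcls x \<inter> Hom G e e"
    then obtain b where b: "b \<in> carrier G" "src G b = e" "z = transport b x"
      using c by (auto simp: vcls_def)
    then have "z \<in> Hom G (tgt G b) (tgt G b)"
      using transport_Hom[OF _ x, of b "tgt G b"] by (simp add: Hom_def)
    then have "b \<in> Hom G e e" using z b by (auto simp: Hom_def)
    then show "z \<in> {x}" using transport_vertex[OF _ x] b by simp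
  qed
  have e: "e \<in> ids G" using src_Hom_ids[OF x] .
  have "x = transport e x" using transport_vertex[OF idsE(4)[OF e] x] by simp
  then have "x \<in> vcls x" unfolding vcls_def using c idsE[OF e] by blast
  then show "{x} \<subseteq> vcls x \<inter> Hom G e e" using x by simp
qed

lemma rep_at_vcls [simp]: "x \<in> Hom G e e \<Longrightarrow> rep_at G e (vcls x) = x"
  unfolding rep_at_def using vcls_Hom by simp

lemma vertex_conj_image:
  assumes x: "x \<in> Hom G e e"
  shows "vertex_conj G `` {x} = vcls x"
proof -
  have "x \<in> vertex_elements G"
    using src_Hom_ids[OF x] x unfolding vertex_elements_def by blast
  then have "vertex_conj G `` {x} = (\<lambda>a. ginv G a \<cdot> x \<cdot> a) ` Out G (src G x)"
    unfolding vertex_conj_def by blast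
  also have "\<dots> = (\<lambda>a. transport a x) ` Out G (src G x)"
    using HomD[OF x] by (intro image_cong) (simp_all add: transport_def Out_def)
  also have "\<dots> = vcls x" unfolding vcls_def Out_def by blast
  finally show ?thesis .
qed

lemma uvg_carrier: "carrier uvg = {vcls x | x e. e \<in> ids G \<and> x \<in> Hom G e e}"
proof -
  have "carrier uvg = {vertex_conj G `` {x} | x e. e \<in> ids G \<and> x \<in> Hom G e e}"
    by (auto simp: universal_vertex_group_def quotient_def vertex_elements_def)
  also have "\<dots> = {vcls x | x e. e \<in> ids G \<and> x \<in> Hom G e e}"
    by (intro Collect_cong iff_exI) (metis vertex_conj_image)
  finally show ?thesis .
qed

lemma vcls_closed: "x \<in> Hom G e e \<Longrightarrow> vcls x \<in> carrier uvg"
  using src_Hom_ids unfolding uvg_carrier by blast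

lemma ex_rep:
  assumes X: "X \<in> carrier uvg" and f: "f \<in> ids G"
  shows "\<exists>x\<in>Hom G f f. X = vcls x"
proof -
  obtain x e where x: "e \<in> ids G" "x \<in> Hom G e e" "X = vcls x" using X unfolding uvg_carrier by blast
  obtain a where a: "a \<in> Hom G e f" using ex_Hom[OF x(1) f] by blast
  show ?thesis using vcls_transport[OF a x(2)] transport_Hom[OF a x(2)] x(3) by auto
qed

lemma rep_at_Hom: "\<lbrakk>X \<in> carrier uvg; f \<in> ids G\<rbrakk> \<Longrightarrow> rep_at G f X \<in> Hom G f f"
  and vcls_rep_at: "\<lbrakk>X \<in> carrier uvg; f \<in> ids G\<rbrakk> \<Longrightarrow> vcls (rep_at G f X) = X"
  using ex_rep[of X f] by (metis rep_at_vcls)+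

lemma rep_at_transport:
  assumes a: "a \<in> Hom G e f" and X: "X \<in> carrier uvg"
  shows "rep_at G f X = transport a (rep_at G e X)"
proof -
  note x = rep_at_Hom[OF X src_Hom_ids[OF a]]
  have "X = vcls (transport a (rep_at G e X))"
    using vcls_transport[OF a x] vcls_rep_at[OF X src_Hom_ids[OF a]] by simp
  then show ?thesis using rep_at_vcls[OF transport_Hom[OF a x]] by simp
qed

text \<open>In the product of classes the two factors may be transported along different arrows.
  These end at the same vertex, so one arrow serves for both and transport is
  multiplicative.\<close>

lemma vcls_mult:
  assumes x: "x \<in> Hom G e e" and y: "y \<in> Hom G e e"
  shows "vcls x \<otimes>\<^bsub>uvg\<^esub> vcls y = vcls (x \<cdot> y)"
proof -
  note c = HomD[OF x] HomD[OF y]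
  have mult: "vcls x \<otimes>\<^bsub>uvg\<^esub> vcls y = {u \<cdot> v | u v. u \<in> vcls x \<and> v \<in> vcls y \<and> src G u = src G v}"
    by (simp add: universal_vertex_group_def)
  have xy: "x \<cdot> y \<in> Hom G e e" using c by (simp add: Hom_def)
  show ?thesis
    unfolding mult
  proof (intro Set.set_eqI iffI)
    fix z
    assume "z \<in> {u \<cdot> v | u v. u \<in> vcls x \<and> v \<in> vcls y \<and> src G u = src G v}"
    then obtain a b where ab: "a \<in> carrier G" "src G a = e" "b \<in> carrier G" "src G b = e"
      "src G (transport a x) = src G (transport b y)" "z = transport a x \<cdot> transport b y"
      using c by (auto simp: vcls_def)
    have a: "a \<in> Hom G e (tgt G a)" and b: "b \<in> Hom G e (tgt G b)" using ab by (auto simp: Hom_def)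
    have "tgt G a = tgt G b"
      using ab(5) HomD[OF transport_Hom[OF a x]] HomD[OF transport_Hom[OF b y]] by simp
    then have b': "b \<in> Hom G e (tgt G a)" using b by simp
    have "transport b y = transport a y"
      using rep_at_transport[OF a vcls_closed[OF y]] rep_at_transport[OF b' vcls_closed[OF y]] y by simp
    then have "z = transport a (x \<cdot> y)" using ab transport_mult[OF a x y] by simp
    then show "z \<in> vcls (x \<cdot> y)" unfolding vcls_def using ab(1,2) c by auto
  next
    fix z assume "z \<in> vcls (x \<cdot> y)"
    then obtain a where a: "a \<in> carrier G" "src G a = e" "z = transport a (x \<cdot> y)"
      using c by (auto simp: vcls_def)
    have a': "a \<in> Hom G e (tgt G a)" using a by (auto simp: Hom_def)
    have "z = transport a x \<cdot> transport a y" using transport_mult[OF a' x y] a by simp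
    moreover have "src G (transport a x) = src G (transport a y)"
      using HomD[OF transport_Hom[OF a' x]] HomD[OF transport_Hom[OF a' y]] by simp
    moreover have "transport a x \<in> vcls x" "transport a y \<in> vcls y"
      unfolding vcls_def using a c by auto
    ultimately show "z \<in> {u \<cdot> v | u v. u \<in> vcls x \<and> v \<in> vcls y \<and> src G u = src G v}"
      by blast
  qed
qed

text \<open>Transporting an identity yields the identity at the end of the arrow, and by
  connectedness every vertex is reached from \<open>e\<close>.\<close>

lemma vcls_id:
  assumes e: "e \<in> ids G"
  shows "vcls e = \<one>\<^bsub>uvg\<^esub>"
proof -
  have tr: "transport a e = tgt G a" if "a \<in> Hom G e f" for a f
    using HomD[OF that] by (simp add: transport_def)
  have "vcls e = ids G"
  proof (intro Set.set_eqI iffI)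
    fix z
    show "z \<in> ids G" if z: "z \<in> vcls e"
    proof -
      obtain a where a: "a \<in> carrier G" "src G a = e" "z = transport a e"
        using z idsE[OF e] unfolding vcls_def by auto
      then have "z = tgt G a" using tr[OF HomI[OF a(1,2) refl]] by simp
      then show ?thesis using a by simp
    qed
    assume z: "z \<in> ids G"
    then obtain a where a: "a \<in> Hom G e z" using ex_Hom e by blast
    then have "z = transport a e" using tr[OF a] HomD[OF a] by simp
    then show "z \<in> vcls e" unfolding vcls_def using HomD[OF a] idsE[OF e] by auto
  qed
  then show ?thesis by (simp add: universal_vertex_group_def)
qed

definition vgroup :: "'a \<Rightarrow> 'a monoid" where
  "vgroup e = \<lparr>carrier = Hom G e e, monoid.mult = (\<cdot>), one = e\<rparr>"

lemma vgroup_comm_group: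
  assumes e: "e \<in> ids G"
  shows "comm_group (vgroup e)"
proof (rule comm_groupI)
  show "\<exists>y\<in>carrier (vgroup e). y \<otimes>\<^bsub>vgroup e\<^esub> x = \<one>\<^bsub>vgroup e\<^esub>" if "x \<in> carrier (vgroup e)" for x
    using that by (intro bexI[of _ "ginv G x"]) (auto simp: vgroup_def Hom_def)
  show "x \<otimes>\<^bsub>vgroup e\<^esub> y = y \<otimes>\<^bsub>vgroup e\<^esub> x"
    if "x \<in> carrier (vgroup e)" "y \<in> carrier (vgroup e)" for x y
    using that vertex_commute by (simp add: vgroup_def)
qed (use idsE[OF e] in \<open>auto simp: vgroup_def Hom_def\<close>)

text \<open>The group laws are carried over from the vertex group at \<open>e\<close> along
  \<open>vcls\<close>, whose inverse is \<open>rep_at G e\<close>. An object has to be given, since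
  without objects the carrier is empty.\<close>

lemma uvg_comm_group:
  assumes e: "e \<in> ids G"
  shows "comm_group uvg"
proof -
  interpret V: comm_group "vgroup e" by (rule vgroup_comm_group[OF e])
  have "vcls \<in> iso (vgroup e) uvg"
  proof (rule isoI)
    show "vcls \<in> hom (vgroup e) uvg"
      by (rule homI) (simp_all add: vgroup_def vcls_closed vcls_mult)
    show "bij_betw vcls (carrier (vgroup e)) (carrier uvg)"
    proof (rule bij_betw_byWitness[where f' = "rep_at G e"])
      show "vcls ` carrier (vgroup e) \<subseteq> carrier uvg"
        using vcls_closed by (auto simp: vgroup_def)
      show "rep_at G e ` carrier uvg \<subseteq> carrier (vgroup e)"
        using rep_at_Hom e by (auto simp: vgroup_def)
    qed (use e in \<open>simp_all add: vgroup_def vcls_rep_at\<close>)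
  qed
  from V.iso_imp_img_comm_group[OF this] show ?thesis
    using vcls_id[OF e] by (simp add: vgroup_def)
qed

lemma rep_at_mult:
  assumes "X \<in> carrier uvg" "Y \<in> carrier uvg" "e \<in> ids G"
  shows "rep_at G e (X \<otimes>\<^bsub>uvg\<^esub> Y) = rep_at G e X \<cdot> rep_at G e Y"
proof -
  note X = rep_at_Hom[OF assms(1,3)] and Y = rep_at_Hom[OF assms(2,3)]
  have "rep_at G e X \<cdot> rep_at G e Y \<in> Hom G e e" using HomD[OF X] HomD[OF Y] by (simp add: Hom_def)
  from rep_at_vcls[OF this] show ?thesis
    using vcls_mult[OF X Y] vcls_rep_at assms by simp
qed

lemma rep_at_one: "e \<in> ids G \<Longrightarrow> rep_at G e \<one>\<^bsub>uvg\<^esub> = e"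
  using rep_at_vcls[OF idsE(4), of e] vcls_id by simp

lemma rep_at_mono_iff:
  assumes "X \<in> carrier uvg" "Y \<in> carrier uvg" "e \<in> ids G" "f \<in> ids G"
    and "rep_at G e X \<preceq> rep_at G e Y"
  shows "rep_at G f X \<preceq> rep_at G f Y"
proof -
  obtain a where a: "a \<in> Hom G e f" using ex_Hom assms by blast
  show ?thesis
    unfolding rep_at_transport[OF a assms(1)] rep_at_transport[OF a assms(2)]
    by (rule transport_mono[OF a rep_at_Hom rep_at_Hom]) (use assms in simp_all)
qed

lemma rep_at_inj:
  "\<lbrakk>X \<in> carrier uvg; Y \<in> carrier uvg; e \<in> ids G; rep_at G e X = rep_at G e Y\<rbrakk> \<Longrightarrow> X = Y"
  by (metis vcls_rep_at)

end

section \<open>Primes and atoms\<close>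

context arithmetical_groupoid
begin

definition primes :: "'a set set" where
  "primes = {vcls p | p e. p \<in> maxv e}"

lemma transport_id: "\<lbrakk>a \<in> Hom G e f\<rbrakk> \<Longrightarrow> transport a e = f"
  by (auto simp: transport_def Hom_def)

lemma maxv_Hom: "p \<in> maxv e \<Longrightarrow> p \<in> Hom G e e"
  by (simp add: maxv_def)

lemma transport_integral:
  assumes a: "a \<in> Hom G e f" and x: "x \<in> Hom G e e" "x \<in> integral G"
  shows "transport a x \<in> integral G"
proof -
  have "x \<preceq> e" using x by (auto simp: integral_iff Hom_def)
  from transport_mono[OF a x(1) idsE(4)[OF src_Hom_ids[OF a]] this] show ?thesis
    using HomD[OF transport_Hom[OF a x(1)]] transport_id[OF a] by (simp add: integral_iff)
qed

text \<open>Transport along \<open>ginv G a\<close> undoes transport along \<open>a\<close> and both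
  preserve the order, so an integral vertex element above the image comes from one above
  \<open>p\<close>.\<close>

lemma transport_maxv:
  assumes a: "a \<in> Hom G e f" and p: "p \<in> maxv e"
  shows "transport a p \<in> maxv f"
proof -
  note pH = maxv_Hom[OF p] and b = ginv_Hom[OF a]
  note tH = transport_Hom[OF a pH]
  have retr: "transport a (transport (ginv G a) x) = x" if "x \<in> Hom G f f" for x
    using transport_ginv[OF b that] HomD(1)[OF a] by simp
  have "x = transport a p \<or> x = f"
    if x: "x \<in> Hom G f f" "x \<in> integral G" "transport a p \<preceq> x" for x
  proof -
    let ?y = "transport (ginv G a) x"
    have y: "?y \<in> Hom G e e" "?y \<in> integral G"
      using transport_Hom[OF b x(1)] transport_integral[OF b x(1,2)] by auto
    have "p \<preceq> ?y" using transport_mono[OF b tH x(1,3)] transport_ginv[OF a pH] by simp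
    then have "?y = p \<or> ?y = e" using p y by (auto simp: maxv_def)
    then show ?thesis using retr[OF x(1)] transport_id[OF a] by auto
  qed
  moreover have "transport a p \<noteq> f"
    using transport_ginv[OF a pH] transport_id[OF b] maxvD(6)[OF p] by auto
  ultimately show ?thesis
    unfolding maxv_def using tH transport_integral[OF a pH maxvD(5)[OF p]] by auto
qed

lemma rep_at_primes: "\<lbrakk>P \<in> primes; f \<in> ids G\<rbrakk> \<Longrightarrow> rep_at G f P \<in> maxv f"
proof -
  assume P: "P \<in> primes" and f: "f \<in> ids G"
  obtain p e where p: "p \<in> maxv e" "P = vcls p" using P by (auto simp: primes_def)
  obtain a where a: "a \<in> Hom G e f" using ex_Hom[OF maxvD(8)[OF p(1)] f] by blast
  show ?thesis
    using rep_at_transport[OF a vcls_closed[OF maxv_Hom[OF p(1)]]] transport_maxv[OF a p(1)]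
      maxv_Hom[OF p(1)] p(2) by simp
qed

lemma vcls_primes: "p \<in> maxv e \<Longrightarrow> vcls p \<in> primes"
  by (auto simp: primes_def)

lemma primes_closed: "primes \<subseteq> carrier uvg"
  using vcls_closed[OF maxv_Hom] by (auto simp: primes_def)

lemma mult_integral_le:
  assumes a: "a \<in> carrier G" and c: "c \<in> integral G" "tgt G a = src G c"
  shows "a \<cdot> c \<preceq> a"
proof -
  have "a \<cdot> c \<preceq> a \<cdot> src G c"
    using a c by (intro mult_left_mono) (simp_all add: integral_iff)
  then show ?thesis using a c(2) by simp
qed

lemma integral_inverse:
  assumes "a \<in> integral G" "b \<in> integral G" "tgt G a = src G b" "a \<cdot> b = src G a"
  shows "a = src G a"
proof -
  have c: "a \<in> carrier G" "b \<in> carrier G" "b \<preceq> src G b" "a \<preceq> src G a" using assms by (auto simp: integral_iff)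
  have "a \<cdot> b \<preceq> a" using mult_integral_le[OF c(1) assms(2,3)] .
  then show ?thesis using le_antisym[of a "src G a"] c(1,4) assms(4) by simp
qed

text \<open>An invertible integral element lies between its source and its product with the inverse,
  which are equal. The set \<open>K\<close> is kept general because both \<open>integral G\<close>
  and \<open>H\<close> are needed.\<close>

lemma isos_restrict_cat:
  assumes K: "K \<subseteq> integral G"
  shows "isos (restrict_cat G K) = {e \<in> K. src G e = e}"
proof (intro Set.set_eqI iffI)
  fix a
  show "a \<in> {e \<in> K. src G e = e}" if "a \<in> isos (restrict_cat G K)"
    using that K integral_inverse unfolding isos_def Hom_def by fastforce
  show "a \<in> isos (restrict_cat G K)" if a: "a \<in> {e \<in> K. src G e = e}"
  proof -
    have "a \<in> carrier G" "src G a = a" using a K by (auto simp: integral_iff)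
    then have "tgt G a = a" "a \<cdot> a = a" using tgt_src[of a] cmp_id[of a a] by auto
    then show ?thesis unfolding isos_def Hom_def using a by auto
  qed
qed

text \<open>For \<open>v\<close> with the source of \<open>u\<close>, the cofactor
  \<open>ginv G v \<cdot> u\<close> is integral as soon as \<open>u \<preceq> v\<close>. Left
  divisors of \<open>u\<close> are thus the integral elements above it, and being an atom becomes a
  maximality condition.\<close>

lemma atoms_iff:
  "u \<in> atoms (restrict_cat G (integral G)) \<longleftrightarrow>
    u \<in> integral G \<and> u \<noteq> src G u \<and>
    (\<forall>v\<in>integral G. src G v = src G u \<and> u \<preceq> v \<longrightarrow> v = u \<or> v = src G u)"
    (is "_ \<longleftrightarrow> ?R")
proof
  note isos = isos_restrict_cat[OF order_refl]
  assume u: "u \<in> atoms (restrict_cat G (integral G))"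
  then have ui: "u \<in> integral G" "u \<noteq> src G u"
    unfolding atoms_def isos by auto
  have uc: "u \<in> carrier G" using ui by (simp add: integral_iff)
  have "v = u \<or> v = src G u" if v: "v \<in> integral G" "src G v = src G u" "u \<preceq> v" for v
  proof -
    have vc: "v \<in> carrier G" using v by (simp add: integral_iff)
    define w where "w = ginv G v \<cdot> u"
    have w: "w \<in> carrier G" "src G w = tgt G v" "tgt G w = tgt G u" "u = v \<cdot> w"
      using uc vc v(2) by (simp_all add: w_def)
    have "w \<preceq> tgt G v" using mult_left_mono[OF v(3), of "ginv G v"] uc vc v(2) by (simp add: w_def)
    then have wi: "w \<in> integral G" using w by (simp add: integral_iff)
    have "v \<in> isos (restrict_cat G (integral G)) \<or> w \<in> isos (restrict_cat G (integral G))"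
      using u v(1) wi w(2,4) unfolding atoms_def by auto
    then consider "src G v = v" | "src G w = w" unfolding isos by blast
    then show ?thesis
    proof cases
      case 1 then show ?thesis using v(2) by simp
    next
      case 2
      then have "tgt G v = w" using w(2) by simp
      then have "v \<cdot> w = v" using vc by simp
      then show ?thesis using w(4) by simp
    qed
  qed
  then show ?R using ui by blast
next
  note isos = isos_restrict_cat[OF order_refl]
  assume R: ?R
  have uc: "u \<in> carrier G" using R by (simp add: integral_iff)
  have "src G b = b \<or> src G c = c"
    if bc: "b \<in> integral G" "c \<in> integral G" "tgt G b = src G c" "u = b \<cdot> c" for b c
  proof -
    have c: "b \<in> carrier G" "c \<in> carrier G" "c \<preceq> src G c" using bc by (auto simp: integral_iff)
    have "b \<cdot> c \<preceq> b" using mult_integral_le[OF c(1) bc(2,3)] .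
    then have "b = u \<or> b = src G u" using R bc c by auto
    moreover have "src G c = c" if "b = u"
    proof -
      have "b \<cdot> c = b \<cdot> src G c" using that bc c by simp
      from left_cancel[OF c(1,2) src_closed[OF c(2)] _ _ this] show ?thesis using bc(3) c by simp
    qed
    moreover have "src G b = src G u" using bc(3,4) c by simp
    ultimately show ?thesis by auto
  qed
  then show "u \<in> atoms (restrict_cat G (integral G))"
    unfolding atoms_def isos using R by auto
qed

lemma ex_join_Hom:
  assumes x: "x \<in> Hom G e f" and y: "y \<in> Hom G e f"
  obtains j where "j \<in> Hom G e f" "x \<preceq> j" "y \<preceq> j"
    "\<And>z. \<lbrakk>z \<in> carrier G; src G z = e; x \<preceq> z; y \<preceq> z\<rbrakk> \<Longrightarrow> j \<preceq> z"
proof (rule ex_join[of x y])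
  note xD = HomD[OF x] and yD = HomD[OF y]
  show "x \<in> carrier G" "y \<in> carrier G" "src G x = src G y" using xD yD by simp_all
  fix j assume j: "j \<in> carrier G" "src G j = src G x" "x \<preceq> j" "y \<preceq> j"
    "\<And>z. \<lbrakk>z \<in> carrier G; src G z = src G x; x \<preceq> z; y \<preceq> z\<rbrakk> \<Longrightarrow> j \<preceq> z"
    "tgt G x = tgt G y \<Longrightarrow> tgt G j = tgt G x"
  show thesis
    by (rule that[of j]) (use j xD yD in \<open>auto simp: Hom_def\<close>)
qed

text \<open>The analogue of the largest two-sided ideal contained in a one-sided ideal.\<close>

definition vbelow :: "'a \<Rightarrow> 'a \<Rightarrow> bool" where
  "vbelow s u \<longleftrightarrow> s \<in> Hom G (src G u) (src G u) \<and> s \<preceq> u \<and>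
    (\<forall>x\<in>Hom G (src G u) (src G u). x \<preceq> u \<longrightarrow> x \<preceq> s)"

text \<open>Composing \<open>u\<close> with an integral arrow back to its source gives a vertex
  element below \<open>u\<close>. The chain condition provides a maximal one, and joins inside the
  vertex group make it the greatest.\<close>

lemma ex_vbelow:
  assumes u: "u \<in> integral G"
  shows "\<exists>s. vbelow s u"
proof -
  define e where "e = src G u"
  have uc: "u \<in> carrier G" "src G u = e" "u \<preceq> e" "e \<in> ids G" using u by (auto simp: integral_iff e_def)
  note eD = idsE[OF uc(4)]
  let ?T = "{x \<in> Hom G e e. x \<preceq> u}"
  have T: "?T \<subseteq> Out G e \<inter> integral G"
  proof
    fix x assume "x \<in> ?T"
    then have x: "x \<in> Hom G e e" "x \<preceq> u" by simp_all
    have "x \<preceq> e"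
      by (rule le_trans[OF x(2) uc(3)]) (use HomD[OF x(1)] uc(1,2) eD(1,2) in simp_all)
    then show "x \<in> Out G e \<inter> integral G"
      using HomD[OF x(1)] by (simp add: Out_def integral_iff)
  qed
  obtain c where c: "c \<in> Hom G (tgt G u) e" "c \<in> integral G"
    using ex_Hom[OF tgt_ids[OF uc(1)] uc(4)] by blast
  have "u \<cdot> c \<preceq> u"
    using mult_integral_le[OF uc(1) c(2)] HomD(2)[OF c(1)] by simp
  moreover have "u \<cdot> c \<in> Hom G e e"
    by (rule HomI) (use uc(1,2) HomD[OF c(1)] in simp_all)
  ultimately have "u \<cdot> c \<in> ?T" by blast
  then have ne: "?T \<noteq> {}" by blast
  obtain s where s: "s \<in> ?T" "\<And>y. \<lbrakk>y \<in> ?T; s \<preceq> y\<rbrakk> \<Longrightarrow> y = s"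
    using ex_maximal[OF T ne uc(4)] by blast
  have sH: "s \<in> Hom G e e" "s \<preceq> u" using s(1) by auto
  have "x \<preceq> s" if x: "x \<in> Hom G e e" "x \<preceq> u" for x
  proof -
    obtain j where j: "j \<in> Hom G e e" "s \<preceq> j" "x \<preceq> j"
        "\<And>z. \<lbrakk>z \<in> carrier G; src G z = e; s \<preceq> z; x \<preceq> z\<rbrakk> \<Longrightarrow> j \<preceq> z"
      using ex_join_Hom[OF sH(1) x(1)] by blast
    have "j \<in> ?T" using j(1) j(4)[OF uc(1,2) sH(2) x(2)] by simp
    then have "j = s" using s(2) j(2) by blast
    then show ?thesis using j(3) by simp
  qed
  then show ?thesis using sH unfolding vbelow_def uc(2) by blast
qed

text \<open>The supremum is attained: \<open>vcls s\<close> belongs to the set and dominates it,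
  since the order on classes can be tested at the source of \<open>u\<close>.\<close>

lemma Phi_eq_vcls:
  assumes u: "u \<in> carrier G" and s: "vbelow s u"
  shows "Phi G u = vcls s"
proof -
  define e where "e = src G u"
  have e: "e \<in> ids G" using u by (simp add: e_def)
  have sH: "s \<in> Hom G e e" and su: "s \<preceq> u"
    and sg: "\<And>x. \<lbrakk>x \<in> Hom G e e; x \<preceq> u\<rbrakk> \<Longrightarrow> x \<preceq> s"
    using s by (auto simp: vbelow_def e_def)
  let ?A = "{X \<in> carrier uvg. rep_at G (src G u) X \<preceq> u}"
  let ?L = "uvg_order G"
  have le: "X \<sqsubseteq>\<^bsub>?L\<^esub> Y \<longleftrightarrow> rep_at G e X \<preceq> rep_at G e Y"
    if "X \<in> carrier uvg" "Y \<in> carrier uvg" for X Y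
    using rep_at_mono_iff[OF that e] e by (auto simp: uvg_order_def)
  have car: "carrier ?L = carrier uvg" by (simp add: uvg_order_def)
  have sA: "vcls s \<in> ?A" using vcls_closed[OF sH] sH su by (simp add: e_def)
  have ub: "vcls s \<in> Upper ?L ?A"
  proof -
    have "X \<sqsubseteq>\<^bsub>?L\<^esub> vcls s" if "X \<in> ?A" for X
      using that le[of X "vcls s"] vcls_closed[OF sH] sH sg[OF rep_at_Hom[OF _ e]] by (simp add: e_def)
    then show ?thesis using vcls_closed[OF sH] by (auto simp: Upper_def car)
  qed
  have lub: "least ?L (vcls s) (Upper ?L ?A)"
    unfolding least_def using ub sA by (auto simp: Upper_def)
  \<comment> \<open>\<open>sup\<close> is a choice among least upper bounds, so its value is known
    only once uniqueness is.\<close>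
  have "X = vcls s" if X: "least ?L X (Upper ?L ?A)" for X
  proof -
    have Xc: "X \<in> carrier uvg" using X by (auto simp: least_def Upper_def car)
    have "X \<sqsubseteq>\<^bsub>?L\<^esub> vcls s" "vcls s \<sqsubseteq>\<^bsub>?L\<^esub> X"
      using X lub unfolding least_def by blast+
    then have "rep_at G e X \<preceq> s" "s \<preceq> rep_at G e X"
      using le Xc vcls_closed[OF sH] sH by auto
    then have "rep_at G e X = s"
      using le_antisym HomD[OF sH] HomD[OF rep_at_Hom[OF Xc e]] by auto
    then show ?thesis using vcls_rep_at[OF Xc e] by simp
  qed
  then show ?thesis unfolding Phi_def sup_def
    using lub by (metis (no_types, lifting) someI)
qed

text \<open>A vertex element \<open>x\<close> above \<open>s\<close> and below \<open>u\<close> is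
  \<open>s\<close>. If \<open>x\<close> is not below \<open>u\<close>, it is comaximal to
  \<open>u\<close>, since nothing but \<open>e\<close> lies properly above an atom; the cofactor of
  \<open>s\<close> by \<open>x\<close> is then already below \<open>s\<close>, which forces
  \<open>x = e\<close>.\<close>

lemma vbelow_maxv:
  assumes u: "u \<in> atoms (restrict_cat G (integral G))" and s: "vbelow s u"
  shows "s \<in> maxv (src G u)"
proof -
  define e where "e = src G u"
  have ui: "u \<in> integral G" "u \<noteq> e"
    and umax: "\<And>v. \<lbrakk>v \<in> integral G; src G v = e; u \<preceq> v\<rbrakk> \<Longrightarrow> v = u \<or> v = e"
    using u unfolding atoms_iff e_def by auto
  have uc: "u \<in> carrier G" "src G u = e" "u \<preceq> e" "e \<in> ids G" using ui by (auto simp: integral_iff e_def)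
  note eD = idsE[OF uc(4)]
  have sH: "s \<in> Hom G e e" and su: "s \<preceq> u"
    and sg: "\<And>x. \<lbrakk>x \<in> Hom G e e; x \<preceq> u\<rbrakk> \<Longrightarrow> x \<preceq> s"
    using s by (auto simp: vbelow_def e_def)
  note sD = HomD[OF sH]
  have se: "s \<preceq> e" using le_trans[OF su uc(3)] sD uc eD by simp
  have "s \<noteq> e" using su ui(2) uc eD le_antisym[of u e] by auto
  moreover have "x = s \<or> x = e" if x: "x \<in> Hom G e e" "x \<in> integral G" "s \<preceq> x" for x
  proof (cases "x \<preceq> u")
    case True
    then show ?thesis using sg[OF x(1)] x(3) HomD[OF x(1)] sD le_antisym[of x s] by auto
  next
    case False
    note xD = HomD[OF x(1)]
    have xu: "comaximal x u"
      unfolding comaximal_def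
    proof (intro ballI impI)
      fix z assume z: "z \<in> integral G" "src G z = src G x \<and> x \<preceq> z \<and> u \<preceq> z"
      then have "z = u \<or> z = e" using umax xD by auto
      then show "z = src G x" using z(2) False xD by auto
    qed
    \<comment> \<open>Commutativity allows \<open>b\<close> to stand on the left,
      \<open>b \<cdot> x = s\<close>. So both \<open>b \<cdot> x\<close> and
      \<open>b \<cdot> u\<close> are below \<open>u\<close>, and comaximality gives
      \<open>b \<preceq> u\<close>.\<close>
    define b where "b = ginv G x \<cdot> s"
    have b: "b \<in> Hom G e e" using xD sD by (simp add: b_def Hom_def)
    note bD = HomD[OF b]
    have "x \<cdot> b = s" using xD sD by (simp add: b_def)
    then have bx: "b \<cdot> x = s" using vertex_commute[OF x(1) b] by simp
    have be: "b \<preceq> e" using mult_left_mono[OF x(3), of "ginv G x"] xD sD by (simp add: b_def)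
    have "b \<cdot> u \<preceq> u" using mult_right_mono[OF be, of u] bD uc eD by simp
    then have "b \<preceq> u"
      using comaximal_mult_left[OF xu x(2) ui(1), of b u] bx su bD uc xD by simp
    then have "b \<preceq> s" using sg[OF b] by simp
    from mult_right_mono[OF this, of "ginv G s"] have "b \<cdot> ginv G s \<preceq> e"
      using bD sD by simp
    from mult_left_mono[OF this, of x] have "x \<cdot> (b \<cdot> ginv G s) \<preceq> x"
      using bD sD eD xD by simp
    moreover have "x \<cdot> (b \<cdot> ginv G s) = (x \<cdot> b) \<cdot> ginv G s"
      by (rule cmp_assoc[symmetric]) (use xD bD sD in simp_all)
    then have "x \<cdot> (b \<cdot> ginv G s) = e"
      unfolding \<open>x \<cdot> b = s\<close> using sD by simp
    moreover have "x \<preceq> e" using x xD by (simp add: integral_iff)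
    ultimately show ?thesis using le_antisym[of x e] xD eD by simp
  qed
  ultimately show ?thesis
    unfolding maxv_def e_def[symmetric] using sH sD se by (auto simp: integral_iff)
qed

lemma rep_at_Phi_atom:
  assumes u: "u \<in> atoms (restrict_cat G (integral G))"
  shows "Phi G u \<in> primes" "vbelow (rep_at G (src G u) (Phi G u)) u"
proof -
  have ui: "u \<in> integral G" using u by (simp add: atoms_iff)
  obtain s where s: "vbelow s u" using ex_vbelow[OF ui] by blast
  have eq: "Phi G u = vcls s" using Phi_eq_vcls[OF _ s] ui by (simp add: integral_iff)
  show "Phi G u \<in> primes" using vcls_primes[OF vbelow_maxv[OF u s]] eq by simp
  have "s \<in> Hom G (src G u) (src G u)" using s by (simp add: vbelow_def)
  then show "vbelow (rep_at G (src G u) (Phi G u)) u" using eq s by simp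
qed

end

section \<open>Products of multisets\<close>

text \<open>The expression agrees with the one in \<open>zero_sum_monoid\<close>; the lemmas below
  give it the recursion over multisets.\<close>

definition mset_prod :: "('c, 'd) monoid_scheme \<Rightarrow> 'c multiset \<Rightarrow> 'c" where
  "mset_prod C M = finprod C (\<lambda>g. g [^]\<^bsub>C\<^esub> count M g) (set_mset M)"

section \<open>Products over multisets in a commutative monoid\<close>

context comm_monoid
begin

lemma mset_prod_superset:
  assumes "finite A" "set_mset M \<subseteq> A" "A \<subseteq> carrier G"
  shows "mset_prod G M = finprod G (\<lambda>g. g [^] count M g) A"
  unfolding mset_prod_def using assms
  by (intro finprod_mono_neutral_cong_left) (auto simp: not_in_iff)

lemma mset_prod_empty [simp]: "mset_prod G {#} = \<one>"
  by (simp add: mset_prod_def)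

lemma mset_prod_closed: "set_mset M \<subseteq> carrier G \<Longrightarrow> mset_prod G M \<in> carrier G"
  unfolding mset_prod_def by (intro finprod_closed) auto

lemma mset_prod_add_mset:
  assumes x: "x \<in> carrier G" and M: "set_mset M \<subseteq> carrier G"
  shows "mset_prod G (add_mset x M) = x \<otimes> mset_prod G M"
proof -
  \<comment> \<open>Over this index set it does not matter whether \<open>x\<close> already occurs
    in \<open>M\<close>; the additional \<open>x\<close> splits off as an indicator factor.\<close>
  let ?A = "insert x (set_mset M)"
  have A: "?A \<subseteq> carrier G" using assms by simp
  have "mset_prod G (add_mset x M) = finprod G (\<lambda>g. g [^] count (add_mset x M) g) ?A"
    using A by (intro mset_prod_superset) auto
  also have "\<dots> = finprod G (\<lambda>g. (if g = x then g else \<one>) \<otimes> g [^] count M g) ?A"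
  proof (rule finprod_cong')
    fix g assume "g \<in> ?A"
    then have "g \<in> carrier G" using A by blast
    then show "g [^] count (add_mset x M) g = (if g = x then g else \<one>) \<otimes> g [^] count M g"
      by (auto simp: m_comm)
  qed (use A in auto)
  also have "\<dots> = finprod G (\<lambda>g. if g = x then g else \<one>) ?A \<otimes> finprod G (\<lambda>g. g [^] count M g) ?A"
    using A by (intro finprod_multf) auto
  also have "finprod G (\<lambda>g. if g = x then g else \<one>) ?A = x"
    using A by (intro finprod_singleton_swap) auto
  also have "finprod G (\<lambda>g. g [^] count M g) ?A = mset_prod G M"
    using A by (intro mset_prod_superset[symmetric]) auto
  finally show ?thesis .
qed

lemma mset_prod_hom:
  assumes D: "comm_monoid D" and f: "f \<in> hom G D" and one: "f \<one> = \<one>\<^bsub>D\<^esub>"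
    and M: "set_mset M \<subseteq> carrier G"
  shows "f (mset_prod G M) = mset_prod D (image_mset f M)"
  using M
proof (induction M)
  case empty
  then show ?case using one comm_monoid.mset_prod_empty[OF D] by simp
next
  case (add x M)
  then have c: "x \<in> carrier G" "set_mset M \<subseteq> carrier G" by auto
  have d: "f x \<in> carrier D" "set_mset (image_mset f M) \<subseteq> carrier D"
    using c f by (auto simp: hom_def)
  have "f (mset_prod G (add_mset x M)) = f x \<otimes>\<^bsub>D\<^esub> f (mset_prod G M)"
    using mset_prod_add_mset[OF c] mset_prod_closed[OF c(2)] c f by (simp add: hom_def)
  then show ?case
    using add.IH[OF c(2)] comm_monoid.mset_prod_add_mset[OF D d] by simp
qed

end

section \<open>Factorizations into atoms\<close>

context arithmetical_groupoid
begin

lemma maxv_comaximal: "\<lbrakk>p \<in> maxv e; q \<in> maxv e; p \<noteq> q\<rbrakk> \<Longrightarrow> comaximal p q"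
  by (subst comaximal_maxv_iff) (use maxv_maximal[of q e p] maxvD[of p e] maxvD[of q e] in auto)

text \<open>Comaximality recovers the support of \<open>M\<close> from its product. The product lies
  below each of its factors, so it is not comaximal to a prime that occurs; primes that do not occur
  are comaximal to every factor, hence to the product.\<close>

lemma rep_at_mset_prod:
  assumes e: "e \<in> ids G" and M: "set_mset M \<subseteq> primes"
  shows "rep_at G e (mset_prod uvg M) \<in> integral G" (is ?I)
    and "P \<in> primes \<Longrightarrow> comaximal (rep_at G e P) (rep_at G e (mset_prod uvg M)) \<longleftrightarrow> P \<notin># M"
proof -
  interpret U: comm_group uvg by (rule uvg_comm_group[OF e])
  note eD = idsE[OF e]
  have main: "rep_at G e (mset_prod uvg M) \<in> integral G \<and>
      (\<forall>P\<in>primes. comaximal (rep_at G e P) (rep_at G e (mset_prod uvg M)) \<longleftrightarrow> P \<notin># M)"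
    using M
  proof (induction M)
    case empty
    have "comaximal (rep_at G e P) e" if P: "P \<in> primes" for P
    proof -
      note p = rep_at_primes[OF P e]
      have "\<not> e \<preceq> rep_at G e P" using maxvD[OF p] le_antisym[of e "rep_at G e P"] by auto
      then show ?thesis using comaximal_maxv_iff[OF p, of e] eD by (simp add: integral_iff)
    qed
    then show ?case using rep_at_one[OF e] eD by (simp add: integral_iff)
  next
    case (add Q M)
    have Q: "Q \<in> primes" and M: "set_mset M \<subseteq> primes" using add.prems by auto
    have Mc: "set_mset M \<subseteq> carrier uvg" using M primes_closed by blast
    have Qc: "Q \<in> carrier uvg" using Q primes_closed by blast
    define q m where "q = rep_at G e Q" and "m = rep_at G e (mset_prod uvg M)"
    have q: "q \<in> maxv e" using rep_at_primes[OF Q e] by (simp add: q_def)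
    have m: "m \<in> Hom G e e" using rep_at_Hom[OF U.mset_prod_closed[OF Mc] e] by (simp add: m_def)
    have mi: "m \<in> integral G"
      and IH: "\<And>P. P \<in> primes \<Longrightarrow> comaximal (rep_at G e P) m \<longleftrightarrow> P \<notin># M"
      using add.IH[OF M] by (simp_all add: m_def)
    note qD = maxvD[OF q] and mD = HomD[OF m]
    have qm: "rep_at G e (mset_prod uvg (add_mset Q M)) = q \<cdot> m"
      using U.mset_prod_add_mset[OF Qc Mc] rep_at_mult[OF Qc U.mset_prod_closed[OF Mc] e]
      by (simp add: q_def m_def)
    have qmi: "q \<cdot> m \<in> integral G" using integral_cmp[OF qD(5) mi] qD mD by simp
    have "comaximal p (q \<cdot> m) \<longleftrightarrow> P \<notin># add_mset Q M"
      if P: "P \<in> primes" and p_def: "p = rep_at G e P" for P p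
    proof -
      have p: "p \<in> maxv e" using rep_at_primes[OF P e] p_def by simp
      note pD = maxvD[OF p]
      have iff: "comaximal p x \<longleftrightarrow> \<not> x \<preceq> p" if "x \<in> integral G" "src G x = e" "tgt G x = e" for x
        using comaximal_maxv_iff[OF p that] .
      have qmH: "src G (q \<cdot> m) = e" "tgt G (q \<cdot> m) = e" "q \<cdot> m = m \<cdot> q"
        using qD mD vertex_commute[OF maxv_Hom[OF q] m] by simp_all
      have qm_le: "q \<cdot> m \<preceq> q" "q \<cdot> m \<preceq> m"
        using mult_integral_le[OF qD(1) mi] mult_integral_le[OF mD(1) qD(5)] qmH(3) qD mD
        by simp_all
      have trans: "q \<cdot> m \<preceq> p" if "x \<preceq> p" "q \<cdot> m \<preceq> x" "x \<in> integral G" "src G x = e" for x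
        by (rule le_trans[of "q \<cdot> m" x p]) (use that qD mD pD in \<open>simp_all add: integral_iff\<close>)
      show ?thesis
      proof
        assume co: "comaximal p (q \<cdot> m)"
        have nle: "\<not> q \<cdot> m \<preceq> p" using iff[OF qmi qmH(1,2)] co by simp
        have "P \<noteq> Q" using nle qm_le(1) p_def q_def by auto
        moreover have "P \<notin># M"
          using nle trans[OF _ qm_le(2) mi mD(2)] iff[OF mi mD(2,3)] IH[OF P] p_def by auto
        ultimately show "P \<notin># add_mset Q M" by simp
      next
        assume "P \<notin># add_mset Q M"
        then have PQ: "P \<noteq> Q" "P \<notin># M" by auto
        have "p \<noteq> q"
          using rep_at_inj[OF _ Qc e, of P] P primes_closed PQ(1) p_def q_def by blast
        then have "comaximal p q" using maxv_comaximal[OF p q] by simp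
        moreover have "comaximal p m" using IH[OF P] PQ(2) p_def by simp
        ultimately show "comaximal p (q \<cdot> m)"
          using comaximal_mult[OF _ _ pD(5) maxv_Hom[OF p] qD(5) maxv_Hom[OF q] mi mD(2)] by simp
      qed
    qed
    then show ?case using qm qmi by simp
  qed
  show ?I using main by simp
  show "comaximal (rep_at G e P) (rep_at G e (mset_prod uvg M)) \<longleftrightarrow> P \<notin># M" if "P \<in> primes"
    using main that by blast
qed

text \<open>Equal products have equal supports, so a prime of \<open>M\<close> also occurs in
  \<open>N\<close> and can be cancelled from both.\<close>

lemma mset_prod_primes_inject:
  assumes e: "e \<in> ids G" and M: "set_mset M \<subseteq> primes" and N: "set_mset N \<subseteq> primes"
    and eq: "mset_prod uvg M = mset_prod uvg N"
  shows "M = N"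
  using M N eq
proof (induction M arbitrary: N)
  interpret U: comm_group uvg by (rule uvg_comm_group[OF e])
  have same: "P \<in># M \<longleftrightarrow> P \<in># N"
    if "P \<in> primes" "set_mset M \<subseteq> primes" "set_mset N \<subseteq> primes"
      "mset_prod uvg M = mset_prod uvg N" for P M N
    using rep_at_mset_prod(2)[OF e that(2,1)] rep_at_mset_prod(2)[OF e that(3,1)] that(4) by simp
  {
    case empty
    have "P \<notin># N" for P
      using same[OF _ empty.prems, of P] empty.prems(2) by auto
    then show ?case by (metis multiset_nonemptyE)
  next
    case (add P M)
    have P: "P \<in> primes" using add.prems by auto
    have "P \<in># N" using same[OF P add.prems] by simp
    then obtain N' where N: "N = add_mset P N'" by (metis multi_member_split)
    have sub: "set_mset M \<subseteq> primes" "set_mset N' \<subseteq> primes" using add.prems N by auto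
    have car: "P \<in> carrier uvg" "set_mset M \<subseteq> carrier uvg" "set_mset N' \<subseteq> carrier uvg"
      using P sub primes_closed by auto
    have "P \<otimes>\<^bsub>uvg\<^esub> mset_prod uvg M = P \<otimes>\<^bsub>uvg\<^esub> mset_prod uvg N'"
      using add.prems(3) N U.mset_prod_add_mset[OF car(1,2)] U.mset_prod_add_mset[OF car(1,3)]
      by simp
    then have "mset_prod uvg M = mset_prod uvg N'"
      using U.Units_l_cancel[of P] car U.mset_prod_closed by (simp only: U.Units_eq)
    then show ?case using add.IH[OF sub] N by simp
  }
qed

abbreviation gatoms :: "'a set" where
  "gatoms \<equiv> atoms (restrict_cat G (integral G))"

text \<open>A relation, because an element has many factorizations into atoms; that they all carry
  the same multiset is proved only later, in \<open>factors_unique\<close>.\<close>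

inductive factors :: "'a \<Rightarrow> 'a set multiset \<Rightarrow> bool" where
  factors_id: "e \<in> ids G \<Longrightarrow> factors e {#}"
| factors_cmp: "\<lbrakk>u \<in> gatoms; factors b M; tgt G u = src G b\<rbrakk>
    \<Longrightarrow> factors (u \<cdot> b) (add_mset (Phi G u) M)"

lemma gatomsD: "u \<in> gatoms \<Longrightarrow> u \<in> integral G" "u \<in> gatoms \<Longrightarrow> u \<in> carrier G"
  "u \<in> gatoms \<Longrightarrow> u \<noteq> src G u"
  by (auto simp: atoms_iff integral_iff)

lemma factors_integral: "factors a M \<Longrightarrow> a \<in> integral G"
proof (induction rule: factors.induct)
  case (factors_id e)
  then show ?case using idsE[of e] by (simp add: integral_iff)
qed (simp add: integral_cmp gatomsD)

lemma factors_carrier: "factors a M \<Longrightarrow> a \<in> carrier G"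
  using factors_integral by (simp add: integral_iff)

lemma factors_primes: "factors a M \<Longrightarrow> set_mset M \<subseteq> primes"
  by (induction rule: factors.induct) (use rep_at_Phi_atom(1) in auto)

lemma factors_append:
  "\<lbrakk>factors a M; factors b N; tgt G a = src G b\<rbrakk> \<Longrightarrow> factors (a \<cdot> b) (M + N)"
proof (induction arbitrary: N rule: factors.induct)
  case (factors_id e)
  then have "e \<cdot> b = b" using idsE[of e] factors_carrier[of b N] by simp
  then show ?case using factors_id by simp
next
  case (factors_cmp u c M)
  have c: "u \<in> carrier G" "c \<in> carrier G" "b \<in> carrier G"
    using factors_cmp.hyps gatomsD factors_carrier factors_cmp.prems by auto
  have t: "tgt G c = src G b" using factors_cmp.prems(2) factors_cmp.hyps(3) c by simp
  have "factors (c \<cdot> b) (M + N)" using factors_cmp.IH[OF factors_cmp.prems(1) t] .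
  then have "factors (u \<cdot> (c \<cdot> b)) (add_mset (Phi G u) (M + N))"
    using factors.factors_cmp[OF factors_cmp.hyps(1)] factors_cmp.hyps(3) c t by simp
  then show ?case using c t factors_cmp.hyps(3) by simp
qed

text \<open>By \<open>atoms_iff\<close> a maximal element among the integral non-identities above
  \<open>z\<close> is an atom.\<close>

lemma atom_above:
  assumes z: "z \<in> integral G" "z \<noteq> src G z"
  obtains u where "u \<in> gatoms" "src G u = src G z" "z \<preceq> u"
proof -
  let ?T = "{v \<in> integral G. src G v = src G z \<and> z \<preceq> v \<and> v \<noteq> src G z}"
  have zc: "z \<in> carrier G" using z by (simp add: integral_iff)
  have T: "?T \<subseteq> Out G (src G z) \<inter> integral G" by (auto simp: Out_def integral_iff)
  have ne: "?T \<noteq> {}" using z le_refl[OF zc] by blast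
  obtain u where u: "u \<in> ?T" "\<And>y. \<lbrakk>y \<in> ?T; u \<preceq> y\<rbrakk> \<Longrightarrow> y = u"
    using ex_maximal[OF T ne src_ids[OF zc]] by blast
  have "v = u \<or> v = src G u" if v: "v \<in> integral G" "src G v = src G u" "u \<preceq> v" for v
  proof -
    have "z \<preceq> v"
      by (rule le_trans[of z u v]) (use u(1) v zc in \<open>simp_all add: integral_iff\<close>)
    then show ?thesis using u v by auto
  qed
  then have "u \<in> gatoms" unfolding atoms_iff using u(1) by auto
  then show thesis using that u(1) by blast
qed

lemma left_divide:
  assumes "a \<in> integral G" "u \<in> integral G" "src G a = src G u" "a \<preceq> u"
  obtains b where "b \<in> integral G" "tgt G u = src G b" "tgt G b = tgt G a" "a = u \<cdot> b"
proof
  have c: "a \<in> carrier G" "u \<in> carrier G" using assms by (simp_all add: integral_iff)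
  have "ginv G u \<cdot> a \<preceq> ginv G u \<cdot> u"
    by (rule mult_left_mono) (use assms c in simp_all)
  then show "ginv G u \<cdot> a \<in> integral G" using assms(3) c by (simp add: integral_iff)
  show "tgt G u = src G (ginv G u \<cdot> a)" "tgt G (ginv G u \<cdot> a) = tgt G a" "a = u \<cdot> (ginv G u \<cdot> a)"
    using assms(3) c by simp_all
qed

text \<open>An atom above \<open>a\<close> is a left divisor. The cofactor has the same target and
  lies strictly above \<open>a\<close>, so the induction on elements with a common target
  applies.\<close>

lemma factors_exist: "a \<in> integral G \<Longrightarrow> \<exists>M. factors a M"
proof (induction a rule: integral_induct_in)
  case (step a)
  have ac: "a \<in> carrier G" using step.hyps by (simp add: integral_iff)
  show ?case
  proof (cases "a = src G a")
    case True
    then have "a \<in> ids G" using src_ids[OF ac] by simp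
    then show ?thesis using factors_id by blast
  next
    case False
    obtain u where u: "u \<in> gatoms" "src G u = src G a" "a \<preceq> u"
      using atom_above[OF step.hyps False] by blast
    obtain b where b: "b \<in> integral G" "tgt G u = src G b" "tgt G b = tgt G a" "a = u \<cdot> b"
      using left_divide[OF step.hyps gatomsD(1)[OF u(1)] u(2)[symmetric] u(3)] by blast
    have c: "u \<in> carrier G" "b \<in> carrier G" using u b gatomsD by (auto simp: integral_iff)
    have "u \<preceq> tgt G u" using gatomsD(1)[OF u(1)] by (simp add: integral_def)
    from mult_right_mono[OF this c(1) tgt_closed[OF c(1)] c(2) _ b(2)]
    have "a \<preceq> b" using b(2,4) c by simp
    moreover have "b \<noteq> a"
    proof
      assume "b = a"
      then have "u \<cdot> a = src G a \<cdot> a" using b(4) ac by simp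
      moreover have "tgt G u = src G a" using b(2) \<open>b = a\<close> by simp
      ultimately have "u = src G a"
        using right_cancel[OF ac c(1) src_closed[OF ac]] ac by simp
      then show False using gatomsD(3)[OF u(1)] u(2) by simp
    qed
    ultimately obtain M where "factors b M" using step.IH[OF b(1,3)] by blast
    then show ?thesis using factors_cmp[OF u(1) _ b(2)] b(4) by auto
  qed
qed

text \<open>
  The prime \<open>P\<close> stays comaximal to the cofactor \<open>b\<close> of \<open>a = u b\<close>: with representatives \<open>p\<close> of \<open>P\<close>
  and \<open>s\<close> of \<open>\<Phi>(u)\<close>, one has \<open>s = s(a \<or> p) \<le> a \<or> pu\<close> and hence \<open>u = su \<or> pu \<le> a \<or> pu\<close>; now cancel
  \<open>u\<close> on the left.
\<close>

lemma comaximal_factors: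
  assumes "factors a M" "P \<in> primes" "comaximal (rep_at G (src G a) P) a"
  shows "P \<notin># M"
  using assms(1,3)
proof (induction rule: factors.induct)
  case (factors_cmp u b M)
  define e f p s where "e = src G u" and "f = tgt G u" and "p = rep_at G e P"
    and "s = rep_at G e (Phi G u)"
  have c: "u \<in> carrier G" "b \<in> carrier G" "b \<in> integral G" "u \<in> integral G" "src G b = f"
    using gatomsD factors_cmp.hyps factors_carrier factors_integral by (auto simp: f_def)
  have e: "e \<in> ids G" and f: "f \<in> ids G" and uH: "u \<in> Hom G e f"
    using c by (simp_all add: e_def f_def Hom_def)
  have p: "p \<in> maxv e" using rep_at_primes[OF assms(2) e] by (simp add: p_def)
  have s: "s \<in> maxv e" using rep_at_primes[OF rep_at_Phi_atom(1)[OF factors_cmp.hyps(1)] e]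
    by (simp add: s_def)
  have su: "s \<preceq> u" using rep_at_Phi_atom(2)[OF factors_cmp.hyps(1)]
    by (simp add: vbelow_def s_def e_def)
  note pD = maxvD[OF p] and sD = maxvD[OF s] and uD = HomD[OF uH]
  have ubi: "u \<cdot> b \<in> integral G" using integral_cmp[OF c(4,3)] c(5) uD by simp
  have sub: "src G (u \<cdot> b) = e" using uD c by simp
  have co: "comaximal p (u \<cdot> b)" using factors_cmp.prems sub by (simp add: p_def)
  have ub_u: "u \<cdot> b \<preceq> u" using mult_integral_le[OF uD(1) c(3)] c(5) uD by simp
  \<comment> \<open>This serves twice: it makes \<open>s\<close> and \<open>p\<close> comaximal, and
    it shows that \<open>P\<close> is not the norm of the first atom.\<close>
  have "p \<noteq> s"
  proof
    assume "p = s"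
    then have "e \<preceq> u" using comaximalD[OF co pD(5) ubi _ uD(1)] pD(2) sub su ub_u uD(2) by simp
    then have "u = e" using le_antisym[of u e] c(4) uD pD by (simp add: integral_iff)
    then show False using gatomsD(3)[OF factors_cmp.hyps(1)] by (simp add: e_def)
  qed
  then have ps: "comaximal s p" using maxv_comaximal[OF s p] by simp
  have "comaximal (rep_at G f P) b"
    unfolding comaximal_def
  proof (intro ballI impI)
    fix z assume z: "z \<in> integral G"
      "src G z = src G (rep_at G f P) \<and> rep_at G f P \<preceq> z \<and> b \<preceq> z"
    have Pc: "P \<in> carrier uvg" using assms(2) primes_closed by blast
    note pf = rep_at_Hom[OF Pc f]
    have zc: "z \<in> carrier G" "src G z = f" using z HomD[OF pf] by (simp_all add: integral_iff)
    have uz: "u \<cdot> z \<in> carrier G" "src G (u \<cdot> z) = e" using zc uD by simp_all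
    have "u \<cdot> rep_at G f P \<preceq> u \<cdot> z"
      by (rule mult_left_mono) (use z zc uD HomD[OF pf] in simp_all)
    \<comment> \<open>Representatives of \<open>P\<close> at the two ends of \<open>u\<close>
      satisfy \<open>u \<cdot> rep_at G f P = p \<cdot> u\<close>.\<close>
    then have puz: "p \<cdot> u \<preceq> u \<cdot> z"
      using rep_at_transport[OF uH Pc] cmp_transport[OF uH rep_at_Hom[OF Pc e]] by (simp add: p_def)
    have ubz: "u \<cdot> b \<preceq> u \<cdot> z"
      by (rule mult_left_mono) (use z zc uD c in simp_all)
    have "p \<cdot> s \<preceq> p \<cdot> u"
      by (rule mult_left_mono) (use su pD sD uD in simp_all)
    then have "s \<cdot> p \<preceq> p \<cdot> u" using maxv_commute[OF p s] by simp
    then have spz: "s \<cdot> p \<preceq> u \<cdot> z"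
      by (rule le_trans[OF _ puz]) (use pD sD uD uz in simp_all)
    have "s \<cdot> (u \<cdot> b) \<preceq> e \<cdot> (u \<cdot> b)"
      by (rule mult_right_mono[OF sD(4)]) (use sD ubi sub in \<open>simp_all add: integral_iff\<close>)
    then have sub_le: "s \<cdot> (u \<cdot> b) \<preceq> u \<cdot> b" using ubi sub by (simp add: integral_iff)
    have "s \<cdot> (u \<cdot> b) \<preceq> u \<cdot> z"
      by (rule le_trans[OF sub_le ubz]) (use sD c uD uz in simp_all)
    then have suz: "s \<preceq> u \<cdot> z"
      using comaximal_mult_left[OF co pD(5) ubi _ sD(1) _ uz(1)] spz pD sD sub uz by simp
    have "s \<cdot> u \<preceq> s"
      using mult_integral_le[OF sD(1) c(4)] sD uD by simp
    then have "s \<cdot> u \<preceq> u \<cdot> z"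
      by (rule le_trans[OF _ suz]) (use sD uD uz in simp_all)
    then have "u \<preceq> u \<cdot> z"
      using comaximal_mult_right[OF ps sD(5) pD(5) maxv_Hom[OF s] maxv_Hom[OF p] uD(1,2) uz] puz
      by simp
    from mult_left_mono[OF this uD(1) uz(1) ginv_closed[OF uD(1)]]
    have "f \<preceq> z" using uD uz zc by simp
    then have "z = f" using le_antisym[of z f] z zc idsE[OF f] by (simp add: integral_iff)
    then show "z = src G (rep_at G f P)" using HomD[OF pf] by simp
  qed
  then have "P \<notin># M" using factors_cmp.IH c(5) by simp
  moreover have "P \<noteq> Phi G u" using \<open>p \<noteq> s\<close> by (auto simp: p_def s_def)
  ultimately show ?case by simp
qed simp

text \<open>Any atom \<open>u\<close> above both \<open>a\<close> and \<open>p\<close> has the right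
  norm: \<open>p\<close> is below the largest vertex element under \<open>u\<close>, both are in
  \<open>maxv e\<close>, and so they coincide.\<close>

lemma factors_extract:
  assumes aM: "factors a M" and P: "P \<in># M"
  obtains u b where "u \<in> gatoms" "Phi G u = P" "b \<in> integral G" "tgt G u = src G b" "a = u \<cdot> b"
proof -
  define e p where "e = src G a" and "p = rep_at G e P"
  have ai: "a \<in> integral G" "a \<in> carrier G" using aM factors_integral factors_carrier by auto
  have e: "e \<in> ids G" using ai by (simp add: e_def)
  have Pp: "P \<in> primes" using factors_primes[OF aM] P by auto
  have p: "p \<in> maxv e" using rep_at_primes[OF Pp e] by (simp add: p_def)
  note pD = maxvD[OF p]
  have "\<not> comaximal p a" using comaximal_factors[OF aM Pp] P by (auto simp: p_def e_def)
  then obtain z where z: "z \<in> integral G" "src G z = e" "p \<preceq> z" "a \<preceq> z" "z \<noteq> e"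
    using pD(2) unfolding comaximal_def by auto
  obtain u where u: "u \<in> gatoms" "src G u = src G z" "z \<preceq> u"
    using atom_above[OF z(1)] z(2,5) by auto
  have ue: "src G u = e" "u \<in> carrier G" "u \<in> integral G" using u z gatomsD by auto
  have zc: "z \<in> carrier G" using z by (simp add: integral_iff)
  have au: "a \<preceq> u"
    by (rule le_trans[OF z(4) u(3)]) (use ai zc ue z(2) e_def in simp_all)
  have pu: "p \<preceq> u"
    by (rule le_trans[OF z(3) u(3)]) (use pD zc ue z(2) in simp_all)
  let ?s = "rep_at G e (Phi G u)"
  have sv: "vbelow ?s u" using rep_at_Phi_atom(2)[OF u(1)] ue by simp
  have s: "?s \<in> maxv e" using rep_at_primes[OF rep_at_Phi_atom(1)[OF u(1)] e] .
  have "p \<preceq> ?s" using sv pu maxv_Hom[OF p] ue by (simp add: vbelow_def)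
  then have "?s = p" using maxv_maximal[OF p _ _ _ _ ] maxvD[OF s] by blast
  then have "Phi G u = P"
    using rep_at_inj[OF _ _ e] rep_at_Phi_atom(1)[OF u(1)] Pp primes_closed p_def by blast
  moreover obtain b where "b \<in> integral G" "tgt G u = src G b" "a = u \<cdot> b"
    using left_divide[OF ai(1) ue(3) _ au] ue(1) e_def by metis
  ultimately show thesis using that u(1) by blast
qed

end

section \<open>The transfer homomorphism\<close>

context comm_monoid
begin

lemma zero_sum_carrier:
  "carrier (zero_sum_monoid G S) = {M. set_mset M \<subseteq> S \<and> mset_prod G M = \<one>}"
  by (simp add: zero_sum_monoid_def mset_prod_def)

lemma mset_prod_union:
  "\<lbrakk>set_mset M \<subseteq> carrier G; set_mset N \<subseteq> carrier G\<rbrakk>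
    \<Longrightarrow> mset_prod G (M + N) = mset_prod G M \<otimes> mset_prod G N"
proof (induction M)
  case (add x M)
  then show ?case
    using mset_prod_add_mset[of x "M + N"] mset_prod_add_mset[of x M]
    by (simp add: mset_prod_closed m_assoc)
qed (simp add: mset_prod_closed)

lemma zero_sum_category:
  assumes S: "S \<subseteq> carrier G"
  defines "B \<equiv> cat_of_monoid (zero_sum_monoid G S)"
  shows "small_category B" "cancellative B" "reduced B" "ids B = {{#}}"
proof -
  have B: "carrier B = {M. set_mset M \<subseteq> S \<and> mset_prod G M = \<one>}"
    "src B = (\<lambda>_. {#})" "tgt B = (\<lambda>_. {#})" "cmp B = (+)"
    unfolding B_def using zero_sum_carrier by (simp_all add: cat_of_monoid_def zero_sum_monoid_def)
  show "small_category B"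
    using mset_prod_union S by unfold_locales (auto simp: B add.assoc)
  show "cancellative B" by (simp add: cancellative_def B)
  show ids: "ids B = {{#}}" by (auto simp: ids_def B)
  have "isos B = {{#}}" by (auto simp: isos_def Hom_def B)
  then show "reduced B" using ids by (simp add: reduced_def)
qed

end

lemma (in small_category) small_category_restrict_cat:
  assumes K: "subcategory C K"
  shows "small_category (restrict_cat C K)"
proof -
  have "K \<subseteq> carrier C" using K by (simp add: subcategory_def)
  then have c: "a \<in> carrier C" if "a \<in> K" for a using that by blast
  show ?thesis
    using K c by unfold_locales (simp_all add: subcategory_def)
qed

lemma (in groupoid) cancellative_restrict_cat:
  assumes K: "K \<subseteq> carrier G"
  shows "cancellative (restrict_cat G K)"
  unfolding cancellative_def
proof (intro ballI conjI impI)
  fix a b c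
  assume "a \<in> carrier (restrict_cat G K)" "b \<in> carrier (restrict_cat G K)"
    "c \<in> carrier (restrict_cat G K)"
  then have "a \<in> carrier G" "b \<in> carrier G" "c \<in> carrier G" using K by auto
  then show "tgt (restrict_cat G K) a = src (restrict_cat G K) b \<and>
      tgt (restrict_cat G K) a = src (restrict_cat G K) c \<and>
      a \<cdot>\<^bsub>restrict_cat G K\<^esub> b = a \<cdot>\<^bsub>restrict_cat G K\<^esub> c \<Longrightarrow> b = c"
    and "tgt (restrict_cat G K) b = src (restrict_cat G K) a \<and>
      tgt (restrict_cat G K) c = src (restrict_cat G K) a \<and>
      b \<cdot>\<^bsub>restrict_cat G K\<^esub> a = c \<cdot>\<^bsub>restrict_cat G K\<^esub> a \<Longrightarrow> b = c"
    using left_cancel[of a b c] right_cancel[of a b c] by auto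
qed

section \<open>Splitting factorizations, and realizing them with prescribed classes\<close>

context arithmetical_groupoid
begin

lemma abstract_normD:
  assumes "abstract_norm G \<eta>"
  shows "a \<in> carrier G \<Longrightarrow> \<eta> a \<in> carrier uvg"
    and "e \<in> ids G \<Longrightarrow> \<eta> e = \<one>\<^bsub>uvg\<^esub>"
    and "\<lbrakk>a \<in> carrier G; b \<in> carrier G; tgt G a = src G b\<rbrakk> \<Longrightarrow> \<eta> (a \<cdot> b) = \<eta> a \<otimes>\<^bsub>uvg\<^esub> \<eta> b"
    and "u \<in> gatoms \<Longrightarrow> \<eta> u = Phi G u"
  using assms idsE(1,2)[of e] unfolding abstract_norm_def cat_hom_def cat_of_monoid_def
  by (simp, metis cat.select_convs(1), simp, simp)

lemma factors_norm:
  assumes \<eta>: "abstract_norm G \<eta>" and a: "factors a M"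
  shows "\<eta> a = mset_prod uvg M"
  using a
proof (induction rule: factors.induct)
  case (factors_id e)
  interpret U: comm_group uvg by (rule uvg_comm_group[OF factors_id])
  show ?case using abstract_normD(2)[OF \<eta> factors_id] by simp
next
  case (factors_cmp u b M)
  interpret U: comm_group uvg
    by (rule uvg_comm_group[OF src_ids[OF gatomsD(2)[OF factors_cmp.hyps(1)]]])
  have "Phi G u \<in> carrier uvg" "set_mset M \<subseteq> carrier uvg"
    using rep_at_Phi_atom(1)[OF factors_cmp.hyps(1)] factors_primes[OF factors_cmp.hyps(2)]
      primes_closed by auto
  then show ?case
    using abstract_normD(3,4)[OF \<eta>] gatomsD(2) factors_carrier factors_cmp U.mset_prod_add_mset
    by simp
qed

lemma factors_unique:
  assumes "abstract_norm G \<eta>" "factors a M" "factors a N"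
  shows "M = N"
  using mset_prod_primes_inject[OF src_ids[OF factors_carrier[OF assms(2)]]
      factors_primes[OF assms(2)] factors_primes[OF assms(3)]]
    factors_norm[OF assms(1,2)] factors_norm[OF assms(1,3)] by simp

text \<open>\<open>factors_extract\<close> says nothing about the norms of the cofactor. Any
  factorization of it is taken, and \<open>factors_unique\<close> shows that its multiset is what
  remains after removing \<open>P\<close>.\<close>

lemma factors_split:
  assumes \<eta>: "abstract_norm G \<eta>" and a: "factors a (M + N)"
  shows "\<exists>b c. factors b M \<and> factors c N \<and> tgt G b = src G c \<and> a = b \<cdot> c"
  using a
proof (induction M arbitrary: a)
  case empty
  have ac: "a \<in> carrier G" using empty factors_carrier by blast
  show ?case
    using empty factors_id[OF src_ids[OF ac]] ac by (intro exI[of _ "src G a"] exI[of _ a]) simp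
next
  case (add P M)
  obtain u b where u: "u \<in> gatoms" "Phi G u = P" "b \<in> integral G" "tgt G u = src G b" "a = u \<cdot> b"
    using factors_extract[OF add.prems, of P] by auto
  obtain L where L: "factors b L" using factors_exist[OF u(3)] by blast
  have "factors a (add_mset P L)" using factors_cmp[OF u(1) L u(4)] u(2,5) by simp
  then have "add_mset P L = add_mset P M + N" using factors_unique[OF \<eta>] add.prems by blast
  then have "factors b (M + N)" using L by simp
  then obtain c d where cd: "factors c M" "factors d N" "tgt G c = src G d" "b = c \<cdot> d"
    using add.IH by blast
  have car: "u \<in> carrier G" "c \<in> carrier G" "d \<in> carrier G"
    using gatomsD(2)[OF u(1)] cd factors_carrier by auto
  have uc: "tgt G u = src G c" using u(4) cd(3,4) car by simp
  have "factors (u \<cdot> c) (add_mset P M)" using factors_cmp[OF u(1) cd(1) uc] u(2) by simp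
  moreover have "a = (u \<cdot> c) \<cdot> d" "tgt G (u \<cdot> c) = src G d" using u(5) cd(3,4) uc car by simp_all
  ultimately show ?case using cd(2) by blast
qed

lemma factors_mem: "\<lbrakk>factors a M; P \<in># M\<rbrakk> \<Longrightarrow> \<exists>u\<in>gatoms. P = Phi G u"
  by (induction rule: factors.induct) auto

text \<open>The target of a chosen atom is not under control, so the vertex has to vary in the
  induction and the hypothesis has to hold at every vertex.\<close>

lemma factors_realize:
  assumes ex: "\<And>e g. \<lbrakk>e \<in> ids G; g \<in> S\<rbrakk> \<Longrightarrow> \<exists>u\<in>gatoms. src G u = e \<and> f (Phi G u) = g"
  shows "\<lbrakk>e \<in> ids G; set_mset M \<subseteq> S\<rbrakk> \<Longrightarrow> \<exists>a N. src G a = e \<and> factors a N \<and> image_mset f N = M"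
proof (induction M arbitrary: e)
  case empty
  then show ?case using factors_id idsE(2) by (metis image_mset_empty)
next
  case (add g M)
  obtain u where u: "u \<in> gatoms" "src G u = e" "f (Phi G u) = g" using ex add.prems by auto
  have uc: "u \<in> carrier G" using gatomsD(2)[OF u(1)] .
  obtain b N where b: "src G b = tgt G u" "factors b N" "image_mset f N = M"
    using add.IH[OF tgt_ids[OF uc]] add.prems by auto
  have "factors (u \<cdot> b) (add_mset (Phi G u) N)" using factors_cmp[OF u(1) b(2)] b(1) by simp
  moreover have "src G (u \<cdot> b) = e" using u(2) uc factors_carrier[OF b(2)] b(1) by simp
  ultimately show ?case using u(3) b(3) by (metis image_mset_add_mset)
qed

end

theorem theorem4p15:
  fixes G :: "'a ord_cat" and \<eta> :: "'a \<Rightarrow> 'a set" and H :: "'a set"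
  assumes "arithmetical_groupoid G"
    and "abstract_norm G \<eta>"
    and "H \<noteq> {}"
    and "subcategory G H" and "H \<subseteq> integral G"
    and "right_saturated G H"
    and "\<And>a. \<lbrakk>a \<in> carrier G; src G a \<in> ids (restrict_cat G H)\<rbrakk> \<Longrightarrow>
          a \<in> quotients G H \<longleftrightarrow> \<eta> a \<in> norm_subgroup G \<eta> H"
    and "\<And>e g. \<lbrakk>e \<in> ids G; g \<in> atom_classes G \<eta> H\<rbrakk> \<Longrightarrow>
          \<exists>u \<in> atoms (restrict_cat G (integral G)). src G u = e \<and> norm_class G \<eta> H (\<eta> u) = g"
  shows "\<exists>\<theta>. transfer_hom (restrict_cat G H)
           (cat_of_monoid
             (zero_sum_monoid (universal_vertex_group G Mod norm_subgroup G \<eta> H)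
               (atom_classes G \<eta> H))) \<theta>"
proof -
  interpret G: arithmetical_groupoid G by fact
  note norm = assms(2)
  let ?U = "universal_vertex_group G"
  define Q where "Q = norm_subgroup G \<eta> H"
  define D where "D = ?U Mod Q"
  define S where "S = atom_classes G \<eta> H"
  define cls where "cls = norm_class G \<eta> H"
  define B where "B = cat_of_monoid (zero_sum_monoid D S)"
  \<comment> \<open>By \<open>factors_exist\<close> and \<open>factors_unique\<close> this is well
    defined on integral elements, and only there is its value used.\<close>
  define fac where "fac a = (THE M. G.factors a M)" for a
  define \<theta> where "\<theta> a = image_mset cls (fac a)" for a
  have Hi: "a \<in> integral G" "a \<in> carrier G" if "a \<in> H" for a
    using assms(5) that G.integral_iff by auto
  have Hs: "src G a \<in> H" "tgt G a \<in> H" if "a \<in> H" for a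
    using assms(4) that by (auto simp: subcategory_def)
  have Hm: "cmp G a b \<in> H" if "a \<in> H" "b \<in> H" "tgt G a = src G b" for a b
    using assms(4) that by (auto simp: subcategory_def)
  \<comment> \<open>Its source is the object that makes the universal vertex group a group, and
    later the starting vertex in the proof of surjectivity.\<close>
  obtain h where h: "h \<in> H" using assms(3) by blast
  interpret U: comm_group ?U
    by (rule G.uvg_comm_group[OF G.src_ids[OF Hi(2)[OF h]]])
  have \<eta>H: "\<eta> ` H \<subseteq> carrier ?U" using G.abstract_normD(1)[OF norm] Hi by auto
  have Q: "subgroup Q ?U" unfolding Q_def norm_subgroup_def by (rule U.generate_is_subgroup[OF \<eta>H])
  interpret D: comm_group D unfolding D_def by (rule U.abelian_FactGroup[OF Q])
  have clsQ: "cls X = Q #>\<^bsub>?U\<^esub> X" for X by (simp add: cls_def norm_class_def Q_def)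
  have cls_hom: "cls \<in> hom ?U D"
    unfolding clsQ[abs_def] D_def by (rule normal.r_coset_hom_Mod[OF U.subgroup_imp_normal[OF Q]])
  have one: "\<one>\<^bsub>D\<^esub> = Q" by (simp add: D_def FactGroup_def)
  have cls_iff: "cls X = \<one>\<^bsub>D\<^esub> \<longleftrightarrow> X \<in> Q" if "X \<in> carrier ?U" for X
    using U.coset_join1[of Q X] U.coset_join2[OF that Q] that Q by (auto simp: clsQ one)
  have cls_one: "cls \<one>\<^bsub>?U\<^esub> = \<one>\<^bsub>D\<^esub>"
    using cls_iff[OF U.one_closed] subgroup.one_closed[OF Q] by simp
  \<comment> \<open>Summing classes gives the class of \<open>\<eta> a\<close>, so being a zero-sum
    sequence becomes a condition on the norm alone.\<close>
  have prod_iff: "mset_prod D (image_mset cls M) = \<one>\<^bsub>D\<^esub> \<longleftrightarrow> \<eta> a \<in> Q"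
    if M: "G.factors a M" for a M
  proof -
    have "set_mset M \<subseteq> carrier ?U" using G.factors_primes[OF M] G.primes_closed by blast
    from U.mset_prod_hom[OF D.comm_monoid_axioms cls_hom cls_one this]
    have "mset_prod D (image_mset cls M) = cls (\<eta> a)" using G.factors_norm[OF norm M] by simp
    then show ?thesis
      using cls_iff[OF G.abstract_normD(1)[OF norm G.factors_carrier[OF M]]] by simp
  qed
  have S: "S = {cls (Phi G u) | u. u \<in> G.gatoms}"
    unfolding S_def atom_classes_def cls_def
    by (intro Collect_cong iff_exI) (use G.abstract_normD(4)[OF norm] in auto)
  have SD: "S \<subseteq> carrier D"
    using cls_hom G.rep_at_Phi_atom(1) G.primes_closed unfolding S hom_def by blast
  have carB: "M \<in> carrier B \<longleftrightarrow> set_mset M \<subseteq> S \<and> mset_prod D M = \<one>\<^bsub>D\<^esub>" for M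
    unfolding B_def using D.zero_sum_carrier by (simp add: cat_of_monoid_def)
  have Bsimps: "src B = (\<lambda>_. {#})" "tgt B = (\<lambda>_. {#})" "cmp B = (+)"
    by (simp_all add: B_def cat_of_monoid_def zero_sum_monoid_def)
  note Bcat = D.zero_sum_category[OF SD, folded B_def]
  have fac: "fac a = M" if "G.factors a M" for a M
    unfolding fac_def using that G.factors_unique[OF norm] by blast
  have fac_factors: "G.factors a (fac a)" if "a \<in> integral G" for a
    using G.factors_exist[OF that] fac by auto
  have S_factors: "set_mset (image_mset cls M) \<subseteq> S" if "G.factors a M" for a M
    using G.factors_mem[OF that] unfolding S by auto
  \<comment> \<open>Hypothesis 1 makes \<open>a\<close> a quotient and right saturation puts it into
    \<open>H\<close>. The source must already be an object of \<open>H\<close>, so factors are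
    treated from left to right.\<close>
  have memH: "a \<in> H" if "a \<in> integral G" "src G a \<in> H" "\<eta> a \<in> Q" for a
  proof -
    have "a \<in> carrier G" "src G a \<in> ids (restrict_cat G H)"
      using that by (simp_all add: G.integral_iff ids_def)
    then have "a \<in> quotients G H" using assms(7) that(3) by (simp add: Q_def)
    then show ?thesis using assms(6) that(1) by (auto simp: right_saturated_def)
  qed
  have HQ: "\<eta> a \<in> Q" if "a \<in> H" for a
    using that unfolding Q_def norm_subgroup_def by (intro generate.incl) simp
  have ids_fac: "fac e = {#}" if "e \<in> ids G" for e using fac[OF G.factors_id[OF that]] .
  have isosH: "isos (restrict_cat G H) = {e \<in> H. src G e = e}"
    by (rule G.isos_restrict_cat[OF assms(5)])
  have "transfer_hom (restrict_cat G H) B \<theta>"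
    unfolding transfer_hom_def
  proof (intro conjI)
    show "small_category (restrict_cat G H)" by (rule G.small_category_restrict_cat[OF assms(4)])
    show "cancellative (restrict_cat G H)"
      using Hi(2) by (intro G.cancellative_restrict_cat) blast
    show "small_category B" "cancellative B" "reduced B" by (rule Bcat)+
    have \<theta>B: "\<theta> a \<in> carrier B" if a: "a \<in> H" for a
      using carB S_factors[OF fac_factors] prod_iff[OF fac_factors] HQ[OF a] Hi[OF a]
      by (simp add: \<theta>_def)
    have \<theta>_id: "\<theta> (src G a) = {#}" "\<theta> (tgt G a) = {#}" if "a \<in> H" for a
      using ids_fac Hi[OF that] by (simp_all add: \<theta>_def)
    have \<theta>_mult: "\<theta> (cmp G a b) = \<theta> a + \<theta> b" if "a \<in> H" "b \<in> H" "tgt G a = src G b" for a b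
      using fac[OF G.factors_append[OF fac_factors fac_factors]] that Hi by (simp add: \<theta>_def)
    show "cat_hom (restrict_cat G H) B \<theta>"
      unfolding cat_hom_def using \<theta>B \<theta>_id \<theta>_mult by (simp add: Bsimps)
    show "\<theta> ` carrier (restrict_cat G H) = carrier B"
    proof
      show "\<theta> ` carrier (restrict_cat G H) \<subseteq> carrier B" using \<theta>B by auto
      show "carrier B \<subseteq> \<theta> ` carrier (restrict_cat G H)"
      proof
        fix M assume M: "M \<in> carrier B"
        have ex: "\<exists>u\<in>G.gatoms. src G u = e \<and> cls (Phi G u) = g" if "e \<in> ids G" "g \<in> S" for e g
          using assms(8)[of e g] that G.abstract_normD(4)[OF norm] by (auto simp: S_def cls_def)
        obtain a N where a: "src G a = src G h" "G.factors a N" "image_mset cls N = M"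
          using G.factors_realize[OF ex G.src_ids[OF Hi(2)[OF h]]] M carB by blast
        have "\<eta> a \<in> Q" using prod_iff[OF a(2)] a(3) M carB by simp
        then have "a \<in> H" using memH[OF G.factors_integral[OF a(2)]] a(1) Hs(1)[OF h] by simp
        moreover have "\<theta> a = M" using fac[OF a(2)] a(3) by (simp add: \<theta>_def)
        ultimately show "M \<in> \<theta> ` carrier (restrict_cat G H)" by auto
      qed
    qed
    show "{a \<in> carrier (restrict_cat G H). \<theta> a \<in> ids B} = isos (restrict_cat G H)"
    proof -
      have "src G a = a" if a: "a \<in> H" and "\<theta> a = {#}" for a
      proof -
        have "fac a = {#}" using that(2) by (simp add: \<theta>_def)
        then have "G.factors a {#}" using fac_factors[OF Hi(1)[OF a]] by simp
        \<comment> \<open>Composing with an atom adds a prime, so an empty multiset can only come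
          from \<open>factors_id\<close>.\<close>
        then show ?thesis by (cases rule: G.factors.cases) (use G.idsE in auto)
      qed
      moreover have "\<theta> a = {#}" if "a \<in> H" "src G a = a" for a using \<theta>_id(1)[OF that(1)] that(2) by simp
      ultimately show ?thesis unfolding isosH Bcat(4) by auto
    qed
    show "\<forall>a\<in>carrier (restrict_cat G H). \<forall>b1\<in>carrier B. \<forall>b2\<in>carrier B.
        tgt B b1 = src B b2 \<and> \<theta> a = b1 \<cdot>\<^bsub>B\<^esub> b2 \<longrightarrow>
        (\<exists>a1\<in>carrier (restrict_cat G H). \<exists>a2\<in>carrier (restrict_cat G H).
           tgt (restrict_cat G H) a1 = src (restrict_cat G H) a2 \<and>
           a = a1 \<cdot>\<^bsub>restrict_cat G H\<^esub> a2 \<and> \<theta> a1 = b1 \<and> \<theta> a2 = b2)"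
    proof (intro ballI impI)
      fix a b1 b2
      assume "a \<in> carrier (restrict_cat G H)" and b: "b1 \<in> carrier B" "b2 \<in> carrier B"
        and "tgt B b1 = src B b2 \<and> \<theta> a = b1 \<cdot>\<^bsub>B\<^esub> b2"
      then have a: "a \<in> H" and eq: "image_mset cls (fac a) = b1 + b2"
        by (simp_all add: Bsimps \<theta>_def)
      \<comment> \<open>The given splitting concerns classes only. It is lifted to the primes first,
        since \<open>factors_split\<close> works with those.\<close>
      obtain M1 M2 where M: "fac a = M1 + M2" "image_mset cls M1 = b1" "image_mset cls M2 = b2"
        using image_mset_eq_plusD[OF eq] by blast
      obtain a1 a2 where a12: "G.factors a1 M1" "G.factors a2 M2" "tgt G a1 = src G a2" "a = cmp G a1 a2"
        using G.factors_split[OF norm, of a M1 M2] fac_factors[OF Hi(1)[OF a]] M(1) by auto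
      have car: "a1 \<in> carrier G" "a2 \<in> carrier G" using a12 G.factors_carrier by auto
      have "src G a1 = src G a" using a12(3,4) car by simp
      then have a1: "a1 \<in> H"
        using memH[OF G.factors_integral[OF a12(1)]] Hs(1)[OF a] prod_iff[OF a12(1)] b(1) M(2) carB
        by simp
      \<comment> \<open>The source of \<open>a2\<close> is the target of \<open>a1\<close>, which is
        an object of \<open>H\<close> because \<open>a1\<close> has just been shown to lie in
        \<open>H\<close>.\<close>
      have a2: "a2 \<in> H"
        using memH[OF G.factors_integral[OF a12(2)]] Hs(2)[OF a1] a12(3) prod_iff[OF a12(2)] b(2) M(3)
          carB by simp
      have "\<theta> a1 = b1" "\<theta> a2 = b2" using fac[OF a12(1)] fac[OF a12(2)] M(2,3) by (simp_all add: \<theta>_def)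
      then show "\<exists>a1\<in>carrier (restrict_cat G H). \<exists>a2\<in>carrier (restrict_cat G H).
           tgt (restrict_cat G H) a1 = src (restrict_cat G H) a2 \<and>
           a = a1 \<cdot>\<^bsub>restrict_cat G H\<^esub> a2 \<and> \<theta> a1 = b1 \<and> \<theta> a2 = b2"
        using a1 a2 a12(3,4) by (intro bexI[of _ a1] bexI[of _ a2]) simp_all
    qed
  qed
  then show ?thesis unfolding B_def D_def S_def Q_def by blast
qed

end
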